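(* Let $n=p+q$ with $p\ge q$. For any $n\times n$ complex indefinite unitary matrix $U\in\mathrm{U}(p,q)$, there exist two unitary matrices $U_p\in\mathrm{U}(p)$ and $U_q\in\mathrm{U}(q)$, an $n\times n$ indefinite orthogonal matrix $O\in\mathrm{O}(p,q)$, and $q$ unique (up to order and signs) real numbers $\theta_1,\dots,\theta_q$ such that $$U=\begin{bmatrix}U_p&0\\0&U_q\end{bmatrix}\begin{bmatrix}Ch&0&iSh\\0&I_{p-q}&0\\-iSh&0&Ch\end{bmatrix}O,$$ where $Ch=\operatorname{diag}(\cosh\theta_1,\dots,\cosh\theta_q)$ and $Sh=\operatorname{diag}(\sinh\theta_1,\dots,\sinh\theta_q)$.
   Context: With $I_{p,q}=\operatorname{diag}(I_p,-I_q)$, $\mathrm{U}(p,q)=\{G\in\mathbb{C}^{n\times n}:G^HI_{p,q}G=I_{p,q}\}$ ($^H$ the conjugate transpose) and $\mathrm{O}(p,q)=\{G\in\mathbb{R}^{n\times n}:G^TI_{p,q}G=I_{p,q}\}$. The block sizes of the middle factor are $q,\,p-q,\,q$. *)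

theory Defs
  imports
    Jordan_Normal_Form.Schur_Decomposition
    "HOL-Combinatorics.Permutations"
begin

definition indef_mat :: "nat \<Rightarrow> nat \<Rightarrow> 'a :: ring_1 mat" where
  "indef_mat p q = four_block_mat (1\<^sub>m p) (0\<^sub>m p q) (0\<^sub>m q p) (- 1\<^sub>m q)"

definition unitary_group :: "nat \<Rightarrow> complex mat set" where
  "unitary_group n = {U \<in> carrier_mat n n. mat_adjoint U * U = 1\<^sub>m n}"

definition indef_unitary_group :: "nat \<Rightarrow> nat \<Rightarrow> complex mat set" where
  "indef_unitary_group p q =
     {G \<in> carrier_mat (p + q) (p + q). mat_adjoint G * indef_mat p q * G = indef_mat p q}"

definition indef_orthogonal_group :: "nat \<Rightarrow> nat \<Rightarrow> real mat set" where
  "indef_orthogonal_group p q =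
     {G \<in> carrier_mat (p + q) (p + q). transpose_mat G * indef_mat p q * G = indef_mat p q}"

text \<open>Horizontal counterpart of the library's vertical concatenation \<open>@\<^sub>r\<close>.\<close>

definition append_cols :: "'a :: zero mat \<Rightarrow> 'a mat \<Rightarrow> 'a mat" (infixr "@\<^sub>c" 66) where
  "A @\<^sub>c B = four_block_mat A B (0\<^sub>m 0 (dim_col A)) (0\<^sub>m 0 (dim_col B))"

text \<open>Only the values of \<open>\<theta>\<close> on \<open>{..<q}\<close> are used. Indices start at 0:
  the angles are \<open>\<theta> 0, \<dots>, \<theta> (q - 1)\<close>.\<close>

definition cosh_block :: "nat \<Rightarrow> (nat \<Rightarrow> real) \<Rightarrow> complex mat" where
  "cosh_block q \<theta> = mat_diag q (\<lambda>k. complex_of_real (cosh (\<theta> k)))"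

definition sinh_block :: "nat \<Rightarrow> (nat \<Rightarrow> real) \<Rightarrow> complex mat" where
  "sinh_block q \<theta> = mat_diag q (\<lambda>k. complex_of_real (sinh (\<theta> k)))"

text \<open>The natural-number subtraction \<open>p - q\<close> is meaningful only for \<open>q \<le> p\<close>.\<close>

definition hyperbolic_mat :: "nat \<Rightarrow> nat \<Rightarrow> (nat \<Rightarrow> real) \<Rightarrow> complex mat" where
  "hyperbolic_mat p q \<theta> =
     (let Ch = cosh_block q \<theta>; Sh = sinh_block q \<theta> in
        (Ch @\<^sub>c 0\<^sub>m q (p - q) @\<^sub>c \<i> \<cdot>\<^sub>m Sh) @\<^sub>r
        (0\<^sub>m (p - q) q @\<^sub>c 1\<^sub>m (p - q) @\<^sub>c 0\<^sub>m (p - q) q) @\<^sub>r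
        ((- \<i>) \<cdot>\<^sub>m Sh @\<^sub>c 0\<^sub>m q (p - q) @\<^sub>c Ch))"

definition is_factorization ::
  "nat \<Rightarrow> nat \<Rightarrow> complex mat \<Rightarrow> complex mat \<Rightarrow> complex mat \<Rightarrow> (nat \<Rightarrow> real) \<Rightarrow> real mat \<Rightarrow> bool" where
  "is_factorization p q U Up Uq \<theta> Om \<longleftrightarrow>
     Up \<in> unitary_group p \<and> Uq \<in> unitary_group q \<and> Om \<in> indef_orthogonal_group p q \<and>
     U = four_block_mat Up (0\<^sub>m p q) (0\<^sub>m q p) Uq
           * hyperbolic_mat p q \<theta> * map_mat complex_of_real Om"

definition eq_up_to_order_and_signs :: "nat \<Rightarrow> (nat \<Rightarrow> real) \<Rightarrow> (nat \<Rightarrow> real) \<Rightarrow> bool" where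
  "eq_up_to_order_and_signs q \<theta> \<theta>' \<longleftrightarrow>
     (\<exists>\<pi>. \<pi> permutes {..<q} \<and> (\<forall>k<q. \<theta>' k = \<theta> (\<pi> k) \<or> \<theta>' k = - \<theta> (\<pi> k)))"

end

theory Submission
  imports Defs
begin

text \<open>
  Let \<open>J = I\<^bsub>p,q\<^esub>\<close> and \<open>M = U\<^sup>H U = A + \<i>B\<close> with \<open>A\<close> real symmetric positive definite and \<open>B\<close> real
  skew-symmetric. A simultaneous congruence that fixes \<open>J\<close> (Sylvester's law of inertia) makes
  \<open>A = diag d\<close>. The identity \<open>M J M = J\<close> then kills the diagonal blocks of \<open>B\<close> and says
  \<open>d\<^sup>2 = 1 + X X\<^sup>T\<close> and \<open>d\<^sup>2 = 1 + X\<^sup>T X\<close> on the two diagonal blocks, where \<open>X\<close> is the upper right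
  block of \<open>B\<close>. A singular value decomposition of \<open>X\<close> therefore brings \<open>M\<close> to the form
  \<open>O\<^sup>T H(2\<theta>) O\<close> with \<open>O \<in> O(p,q)\<close> and \<open>H\<close> the hyperbolic factor, so that \<open>U O\<^sup>-\<^sup>1 H(-\<theta>)\<close> is both unitary
  and \<open>J\<close>-unitary, hence block diagonal. Conversely, in any factorization \<open>J A\<close> is similar to
  \<open>J diag (cosh 2\<theta>, 1, cosh 2\<theta>)\<close>, whose negative eigenvalues are the numbers \<open>- cosh 2\<theta>\<^sub>k\<close>.
\<close>

section \<open>Real spectral theorem and singular values\<close>

text \<open>Passing to \<open>M\<close> removes the left factor, since a unitary block matrix
  cancels in \<open>U^H U\<close>. What remains is a congruence problem for a real matrix
  \<open>O\<close>, and real congruences act on \<open>A\<close> and \<open>B\<close> separately.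
  The middle factor is Hermitian and satisfies
  \<open>H(\<theta>) H(\<phi>) = H(\<theta> + \<phi>)\<close>, so the angles appear doubled in
  \<open>M\<close>. Positive definiteness of \<open>A\<close> enters at three places. It permits
  diagonalizing \<open>A\<close> together with the indefinite form \<open>J\<close>. It makes sums
  of two entries of \<open>d\<close> nonzero, which is what forces the diagonal blocks of
  \<open>B\<close> to vanish. And it makes \<open>d\<close> the only positive root of
  \<open>d^2\<close>, so that the orthogonal factors of \<open>X\<close>, which visibly diagonalize
  \<open>d^2\<close>, diagonalize \<open>d\<close> as well. A singular value \<open>s\<close> is
  then tied to the entry \<open>sqrt (1 + s^2)\<close> in both blocks: these are the sinh and cosh
  of one angle. For uniqueness, the negative eigenvalues are the ones to look at, because the
  positive ones mix the \<open>cosh 2\<theta>\<close> with the \<open>p - q\<close> ones of the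
  middle block. As cosh is even, only the absolute values of the angles can be recovered.\<close>

definition orthogonal_group :: "nat \<Rightarrow> real mat set" where
  "orthogonal_group n = {P \<in> carrier_mat n n. P\<^sup>T * P = 1\<^sub>m n}"

context
  fixes n :: nat
begin

text \<open>The dimensions in the carrier premises mostly do not occur in the terms being rewritten.
  Fixing all of them to one \<open>n\<close> lets the simplifier discharge these premises and bring
  products of square matrices into right-nested form.\<close>

lemmas square_mat_simps =
  assoc_mult_mat[of _ n n _ n _ n] mult_carrier_mat[of _ n n _ n] transpose_mult[of _ n n _ n]
  left_mult_one_mat[of _ n n] right_mult_one_mat[of _ n n]

end

lemma orthogonal_groupD:
  assumes "P \<in> orthogonal_group n"
  shows "P \<in> carrier_mat n n" "P\<^sup>T * P = 1\<^sub>m n" "P * P\<^sup>T = 1\<^sub>m n"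
proof -
  show P: "P \<in> carrier_mat n n" and PP: "P\<^sup>T * P = 1\<^sub>m n"
    using assms by (auto simp: orthogonal_group_def)
  show "P * P\<^sup>T = 1\<^sub>m n"
    by (rule mat_mult_left_right_inverse[OF _ P PP]) (use P in auto)
qed

lemma orthogonal_group_mult:
  assumes "P \<in> orthogonal_group n" "Q \<in> orthogonal_group n"
  shows "P * Q \<in> orthogonal_group n"
proof -
  note P = orthogonal_groupD[OF assms(1)] and Q = orthogonal_groupD[OF assms(2)]
  have "(P * Q)\<^sup>T * (P * Q) = Q\<^sup>T * (P\<^sup>T * P) * Q"
    using P(1) Q(1) by (simp add: square_mat_simps[where n = n])
  then show ?thesis
    using P Q by (auto simp: orthogonal_group_def right_mult_one_mat[of _ n n])
qed

text \<open>Undoes one deflation step in the two inductions below: the orthogonal matrix found for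
  the smaller block is extended by a fixed first coordinate.\<close>

lemma orthogonal_group_block_one:
  assumes "P \<in> orthogonal_group n"
  shows "four_block_mat (1\<^sub>m 1) (0\<^sub>m 1 n) (0\<^sub>m n 1) P \<in> orthogonal_group (Suc n)"
proof -
  note P = orthogonal_groupD[OF assms]
  show ?thesis using P four_block_one_mat[of 1 n] unfolding orthogonal_group_def
    by (auto simp: transpose_four_block_mat[of _ 1 1 _ n _ n] mult_four_block_mat[of _ 1 1 _ n _ n _ _ 1 _ n])
qed

lemma mult_mat_zero_vec:
  fixes M :: "'a :: semiring_0 mat"
  shows "M \<in> carrier_mat n m \<Longrightarrow> M *\<^sub>v 0\<^sub>v m = 0\<^sub>v n"
  by (intro eq_vecI) auto

lemma real_scalar_prod_self:
  fixes x :: "real vec"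
  assumes "x \<in> carrier_vec n"
  shows "0 \<le> x \<bullet> x" and "x \<bullet> x = 0 \<longleftrightarrow> x = 0\<^sub>v n"
proof -
  have e: "x \<bullet> x = (\<Sum>i<n. (x $ i)\<^sup>2)"
    using assms by (simp add: scalar_prod_def power2_eq_square atLeast0LessThan)
  show "0 \<le> x \<bullet> x" unfolding e by (intro sum_nonneg) auto
  show "x \<bullet> x = 0 \<longleftrightarrow> x = 0\<^sub>v n"
    unfolding e using assms by (subst sum_nonneg_eq_0_iff) (auto intro!: eq_vecI)
qed

lemma real_normalize:
  fixes x :: "real vec"
  assumes x: "x \<in> carrier_vec n" and x0: "x \<noteq> 0\<^sub>v n"
  obtains s u where "u \<in> carrier_vec n" "u \<bullet> u = 1" "x = s \<cdot>\<^sub>v u" "s \<noteq> 0"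
proof -
  have xx: "0 < x \<bullet> x" using real_scalar_prod_self[OF x] x0 by linarith
  show thesis
    by (rule that[of "(1 / sqrt (x \<bullet> x)) \<cdot>\<^sub>v x" "sqrt (x \<bullet> x)"])
      (use x xx in \<open>auto simp: smult_smult_assoc field_simps\<close>)
qed

text \<open>The Householder reflection exchanging \<open>u\<close> and the first unit vector. If \<open>u\<close> already is
  that vector, then the denominator vanishes and the formula yields the identity.\<close>

lemma orthogonal_with_first_col:
  fixes u :: "real vec"
  assumes u: "u \<in> carrier_vec n" and uu: "u \<bullet> u = 1" and n: "0 < n"
  obtains P where "P \<in> orthogonal_group n" "col P 0 = u"
proof -
  define e :: "nat \<Rightarrow> nat \<Rightarrow> real" where "e i j = (if i = j then 1 else 0)" for i j
  define w where "w i = u $ i - e i 0" for i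
  \<comment> \<open>By \<open>ww\<close> below, \<open>c\<close> is half the squared length of
    \<open>w\<close>, so \<open>w w^T / c\<close> is the usual
    \<open>2 w w^T / (w^T w)\<close>.\<close>
  define c where "c = 1 - u $ 0"
  define P where "P = mat n n (\<lambda>(i,j). e i j - w i * w j / c)"
  have uu': "(\<Sum>i<n. u $ i * u $ i) = 1"
    using uu u by (simp add: scalar_prod_def atLeast0LessThan)
  have e_sum: "(\<Sum>k<n. e i k * f k) = f i" "(\<Sum>k<n. f k * e k i) = f i" if "i < n" for i f
    using that unfolding e_def by (simp_all add: if_distrib[of "\<lambda>x. x * _"] if_distrib[of "\<lambda>x. _ * x"]
      cong: if_cong)
  have ww: "(\<Sum>k<n. w k * w k) = 2 * c"
  proof -
    have "(\<Sum>k<n. w k * w k) = (\<Sum>k<n. u $ k * u $ k - 2 * (u $ k * e k 0) + e 0 k * e k 0)"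
      unfolding w_def by (intro sum.cong) (auto simp: algebra_simps e_def)
    also have "\<dots> = 2 * c"
      using n unfolding sum.distrib sum_subtractf sum_distrib_left[symmetric]
      by (simp add: e_sum uu' c_def) (simp add: e_def)
    finally show ?thesis .
  qed
  have w0: "w i = 0" if "c = 0" "i < n" for i
  proof -
    have "(\<Sum>k<n. w k * w k) = 0" using ww that by simp
    then show ?thesis using that by (subst (asm) sum_nonneg_eq_0_iff) auto
  qed
  have "P\<^sup>T * P = 1\<^sub>m n"
  proof (rule eq_matI)
    fix i j assume "i < dim_row (1\<^sub>m n :: real mat)" "j < dim_col (1\<^sub>m n :: real mat)"
    then have i: "i < n" and j: "j < n" by auto
    have "(P\<^sup>T * P) $$ (i, j) = (\<Sum>k<n. (e k i - w k * w i / c) * (e k j - w k * w j / c))"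
      using i j by (simp add: P_def scalar_prod_def atLeast0LessThan)
    also have "\<dots> = (\<Sum>k<n. e i k * e k j - e i k * (w k * w j / c) - (w k * w i / c) * e k j
        + (w i * w j / (c * c)) * (w k * w k))"
      by (intro sum.cong) (auto simp: algebra_simps e_def)
    also have "\<dots> = e i j - 2 * (w i * w j / c) + w i * w j / (c * c) * (2 * c)"
      using i j unfolding sum.distrib sum_subtractf sum_distrib_left[symmetric] ww
        e_sum(1)[OF i] e_sum(2)[OF j] by simp
    also have "\<dots> = e i j" by (cases "c = 0") (simp_all add: field_simps)
    finally show "(P\<^sup>T * P) $$ (i, j) = 1\<^sub>m n $$ (i, j)" using i j by (simp add: e_def)
  qed (auto simp: P_def)
  moreover have "col P 0 = u"
  proof (rule eq_vecI)
    fix i assume "i < dim_vec u"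
    then have i: "i < n" using u by auto
    have "w i * w 0 / c = - w i"
      using w0[OF _ i] by (cases "c = 0") (auto simp: w_def[of 0] e_def c_def field_simps)
    then show "col P 0 $ i = u $ i" using i n by (simp add: P_def w_def)
  qed (use u in \<open>auto simp: P_def\<close>)
  ultimately show thesis by (intro that[of P]) (auto simp: orthogonal_group_def P_def)
qed

text \<open>Padded by zero rows, the vectors of \<open>R\<close> form a square matrix whose last row
  vanishes. Its transpose kills the last unit vector, so the determinant is zero and the matrix
  itself has a nonzero kernel vector.\<close>

lemma exists_orthogonal_vec:
  fixes R :: "'a :: field vec set"
  assumes fin: "finite R" and R: "R \<subseteq> carrier_vec n" and card: "card R < n"
  obtains y where "y \<in> carrier_vec n" "y \<noteq> 0\<^sub>v n" "\<And>r. r \<in> R \<Longrightarrow> r \<bullet> y = 0"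
proof -
  obtain rs where rs: "set rs = R" "distinct rs" using finite_distinct_list[OF fin] by auto
  then have len: "length rs < n" using card distinct_card by fastforce
  define M where "M = mat n n (\<lambda>(i,j). if i < length rs then rs ! i $ j else 0)"
  have M: "M \<in> carrier_mat n n" by (simp add: M_def)
  have "M\<^sup>T *\<^sub>v unit_vec n (n - 1) = 0\<^sub>v n"
    using len by (intro eq_vecI) (auto simp: M_def scalar_prod_right_unit)
  moreover have "unit_vec n (n - 1) \<noteq> (0\<^sub>v n :: 'a vec)" using len by simp
  ultimately have "det M\<^sup>T = 0"
    using M by (subst det_0_iff_vec_prod_zero[of _ n]) (auto intro!: exI[of _ "unit_vec n (n - 1)"])
  then have "det M = 0" using det_transpose[OF M] by simp
  then obtain y where y: "y \<in> carrier_vec n" "y \<noteq> 0\<^sub>v n" "M *\<^sub>v y = 0\<^sub>v n"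
    using det_0_iff_vec_prod_zero[OF M] by auto
  have "r \<bullet> y = 0" if "r \<in> R" for r
  proof -
    obtain i where i: "i < length rs" "r = rs ! i" using \<open>r \<in> R\<close> rs by (metis in_set_conv_nth)
    have "row M i = r" using i R rs len that by (intro eq_vecI) (auto simp: M_def)
    moreover have "(M *\<^sub>v y) $ i = 0" using y(3) i len by simp
    ultimately show ?thesis using i len M by simp
  qed
  with y show thesis by (intro that)
qed

text \<open>The characteristic polynomial splits over the complex numbers, which gives an
  eigenvector \<open>x + i y\<close> for some \<open>k\<close>. Symmetry, in the form
  \<open>x \<bullet> (A y) = (A x) \<bullet> y\<close>, yields
  \<open>Im k * (x \<bullet> x + y \<bullet> y) = 0\<close>. Hence \<open>k\<close> is real, and
  whichever of \<open>x\<close>, \<open>y\<close> is nonzero is a real eigenvector.\<close>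

lemma real_symmetric_eigenvector:
  fixes A :: "real mat"
  assumes A: "A \<in> carrier_mat n n" and sym: "A\<^sup>T = A" and n: "0 < n"
  obtains u l where "u \<in> carrier_vec n" "u \<bullet> u = 1" "A *\<^sub>v u = l \<cdot>\<^sub>v u"
proof -
  let ?A = "map_mat complex_of_real A"
  have cA: "?A \<in> carrier_mat n n" using A by simp
  obtain as where as: "char_poly ?A = (\<Prod>a\<leftarrow>as. [:- a, 1:])" "length as = n"
    using char_poly_factorized[OF cA] by blast
  obtain k as' where "as = k # as'" using n as(2) by (cases as) auto
  then have "eigenvalue ?A k" unfolding eigenvalue_root_char_poly[OF cA] as(1) by simp
  then obtain w where w: "w \<in> carrier_vec n" "w \<noteq> 0\<^sub>v n" "?A *\<^sub>v w = k \<cdot>\<^sub>v w"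
    using cA unfolding eigenvalue_def eigenvector_def by auto
  define x where "x = map_vec Re w"
  define y where "y = map_vec Im w"
  have x: "x \<in> carrier_vec n" and y: "y \<in> carrier_vec n" using w by (auto simp: x_def y_def)
  have entry: "(\<Sum>j<n. complex_of_real (A $$ (i,j)) * w $ j) = k * w $ i" if "i < n" for i
    using arg_cong[OF w(3), of "\<lambda>v. v $ i"] that A w(1)
    by (simp add: scalar_prod_def atLeast0LessThan)
  have Ax: "A *\<^sub>v x = Re k \<cdot>\<^sub>v x - Im k \<cdot>\<^sub>v y"
  proof (rule eq_vecI)
    fix i assume "i < dim_vec (Re k \<cdot>\<^sub>v x - Im k \<cdot>\<^sub>v y)"
    then have i: "i < n" using y by simp
    show "(A *\<^sub>v x) $ i = (Re k \<cdot>\<^sub>v x - Im k \<cdot>\<^sub>v y) $ i"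
      using arg_cong[OF entry[OF i], of Re] i A w(1)
      by (simp add: scalar_prod_def atLeast0LessThan x_def y_def)
  qed (use A y in auto)
  have Ay: "A *\<^sub>v y = Re k \<cdot>\<^sub>v y + Im k \<cdot>\<^sub>v x"
  proof (rule eq_vecI)
    fix i assume "i < dim_vec (Re k \<cdot>\<^sub>v y + Im k \<cdot>\<^sub>v x)"
    then have i: "i < n" using x by simp
    show "(A *\<^sub>v y) $ i = (Re k \<cdot>\<^sub>v y + Im k \<cdot>\<^sub>v x) $ i"
      using arg_cong[OF entry[OF i], of Im] i A w(1)
      by (simp add: scalar_prod_def atLeast0LessThan x_def y_def)
  qed (use A x in auto)
  have xy: "x \<noteq> 0\<^sub>v n \<or> y \<noteq> 0\<^sub>v n"
  proof (rule ccontr)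
    assume "\<not> ?thesis"
    then have x0: "x = 0\<^sub>v n" and y0: "y = 0\<^sub>v n" by auto
    have "w $ i = 0" if "i < n" for i
      using arg_cong[OF x0, of "\<lambda>v. v $ i"] arg_cong[OF y0, of "\<lambda>v. v $ i"] that w(1)
      by (simp add: x_def y_def complex_eq_iff)
    then show False using w by (auto intro!: eq_vecI)
  qed
  have "x \<bullet> (A *\<^sub>v y) = (A *\<^sub>v x) \<bullet> y"
    using transpose_vec_mult_scalar[OF A y x] sym x y A by (simp add: comm_scalar_prod[of _ n])
  then have "Im k * (x \<bullet> x + y \<bullet> y) = 0"
    unfolding Ax Ay using x y
    by (simp add: scalar_prod_add_distrib[of _ n] minus_scalar_prod_distrib[of _ n] algebra_simps)
  moreover have "x \<bullet> x + y \<bullet> y > 0"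
    using xy real_scalar_prod_self[OF x] real_scalar_prod_self[OF y] by linarith
  ultimately have k: "Im k = 0" by auto
  obtain z where z: "z \<in> carrier_vec n" "z \<noteq> 0\<^sub>v n" "A *\<^sub>v z = Re k \<cdot>\<^sub>v z"
  proof (cases "x = 0\<^sub>v n")
    case True
    have "A *\<^sub>v y = Re k \<cdot>\<^sub>v y" unfolding Ay k using x y by (auto intro!: eq_vecI)
    then show ?thesis using xy True y that by auto
  next
    case False
    have "A *\<^sub>v x = Re k \<cdot>\<^sub>v x" unfolding Ax k using x y by (auto intro!: eq_vecI)
    then show ?thesis using False x that by auto
  qed
  obtain c u where u: "u \<in> carrier_vec n" "u \<bullet> u = 1" "z = c \<cdot>\<^sub>v u" "c \<noteq> 0"
    by (rule real_normalize[OF z(1,2)])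
  have "u = (1 / c) \<cdot>\<^sub>v z" using u by (simp add: smult_smult_assoc)
  then have "A *\<^sub>v u = Re k \<cdot>\<^sub>v u"
    using z A by (simp add: mult_mat_vec smult_smult_assoc mult.commute)
  with u(1,2) show thesis by (rule that)
qed

lemma mult_block_diag:
  assumes "A \<in> carrier_mat n n" "A' \<in> carrier_mat n n" "D \<in> carrier_mat m m" "D' \<in> carrier_mat m m"
  shows "four_block_mat A (0\<^sub>m n m) (0\<^sub>m m n) D * four_block_mat A' (0\<^sub>m n m) (0\<^sub>m m n) D' =
    four_block_mat (A * A') (0\<^sub>m n m) (0\<^sub>m m n) (D * D')"
  using assms by (subst mult_four_block_mat[of _ n n _ m _ m _ _ n _ m])
    (auto simp: left_mult_zero_mat[of _ n m] left_mult_zero_mat[of _ m n]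
      right_mult_zero_mat[of _ n n] right_mult_zero_mat[of _ m m] left_mult_zero_mat[of _ m m]
      left_mult_zero_mat[of _ n n] right_add_zero_mat[of _ n n] left_add_zero_mat[of _ m m])

lemma mat_diag_Suc:
  "mat_diag (Suc n) (case_nat a f) =
    four_block_mat (mat 1 1 (\<lambda>_. a)) (0\<^sub>m 1 n) (0\<^sub>m n 1) (mat_diag n f)"
  by (rule eq_matI) (auto simp: mat_diag_def split: nat.split)

text \<open>Deflation: in an orthonormal basis starting with an eigenvector, the first column of
  \<open>M\<close> is a multiple of the first unit vector. Symmetry gives the same for the first
  row, and the induction hypothesis takes care of the remaining block.\<close>

theorem real_spectral:
  fixes A :: "real mat"
  assumes "A \<in> carrier_mat n n" "A\<^sup>T = A"
  shows "\<exists>P\<in>orthogonal_group n. \<exists>d. A = P * mat_diag n d * P\<^sup>T"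
  using assms
proof (induction n arbitrary: A)
  case 0
  then show ?case by (intro bexI[of _ "1\<^sub>m 0"] exI eq_matI) (auto simp: orthogonal_group_def)
next
  case (Suc n)
  note A = Suc.prems(1) and sym = Suc.prems(2)
  obtain u l where u: "u \<in> carrier_vec (Suc n)" "u \<bullet> u = 1" and Au: "A *\<^sub>v u = l \<cdot>\<^sub>v u"
    using real_symmetric_eigenvector[OF A sym] by auto
  obtain P where "P \<in> orthogonal_group (Suc n)" and Pu: "col P 0 = u"
    using orthogonal_with_first_col[OF u] by auto
  note P = this(1) orthogonal_groupD[OF this(1)]
  define M where "M = P\<^sup>T * (A * P)"
  have M: "M \<in> carrier_mat (Suc n) (Suc n)" using P A by (auto simp: M_def)
  have symM: "M\<^sup>T = M"
    using P A sym by (simp add: M_def square_mat_simps[where n = "Suc n"])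
  have "col M 0 = P\<^sup>T *\<^sub>v (A *\<^sub>v u)"
  proof -
    have "col M 0 = P\<^sup>T *\<^sub>v col (A * P) 0"
      unfolding M_def using P A by (intro col_mult2[of _ "Suc n" "Suc n" _ "Suc n"]) auto
    also have "col (A * P) 0 = A *\<^sub>v col P 0"
      using P A by (intro col_mult2[of _ "Suc n" "Suc n" _ "Suc n"]) auto
    finally show ?thesis unfolding Pu .
  qed
  also have "\<dots> = l \<cdot>\<^sub>v (P\<^sup>T *\<^sub>v col P 0)"
    using P u by (simp add: Au Pu mult_mat_vec[of _ "Suc n" "Suc n"])
  also have "P\<^sup>T *\<^sub>v col P 0 = col (P\<^sup>T * P) 0"
    using P by (intro col_mult2[symmetric, of _ "Suc n" "Suc n" _ "Suc n"]) auto
  finally have col: "col M 0 = l \<cdot>\<^sub>v unit_vec (Suc n) 0" using P by simp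
  have M0: "M $$ (i, 0) = (if i = 0 then l else 0)" if "i < Suc n" for i
    using arg_cong[OF col, of "\<lambda>v. v $ i"] that M by auto
  have M0': "M $$ (0, i) = (if i = 0 then l else 0)" if "i < Suc n" for i
    using arg_cong[OF symM, of "\<lambda>B. B $$ (i, 0)"] M0[OF that] that M by auto
  define A' where "A' = mat n n (\<lambda>(i,j). M $$ (Suc i, Suc j))"
  have A': "A' \<in> carrier_mat n n" by (simp add: A'_def)
  have "A'\<^sup>T = A'"
  proof (rule eq_matI)
    fix i j assume ij: "i < dim_row A'" "j < dim_col A'"
    then show "A'\<^sup>T $$ (i, j) = A' $$ (i, j)"
      using arg_cong[OF symM, of "\<lambda>B. B $$ (Suc i, Suc j)"] M by (auto simp: A'_def)
  qed (auto simp: A'_def)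
  then obtain P' d' where "P' \<in> orthogonal_group n" and eq': "A' = P' * mat_diag n d' * P'\<^sup>T"
    using Suc.IH[OF A'] by blast
  note P' = this(1) orthogonal_groupD[OF this(1)]
  define Q where "Q = four_block_mat (1\<^sub>m 1) (0\<^sub>m 1 n) (0\<^sub>m n 1) P'"
  let ?D = "mat_diag (Suc n) (case_nat l d')"
  have Q: "Q \<in> orthogonal_group (Suc n)" unfolding Q_def by (rule orthogonal_group_block_one[OF P'(1)])
  have cQ: "Q \<in> carrier_mat (Suc n) (Suc n)" using orthogonal_groupD[OF Q] by simp
  have "M = four_block_mat (mat 1 1 (\<lambda>_. l)) (0\<^sub>m 1 n) (0\<^sub>m n 1) A'"
    using M M0 M0' by (intro eq_matI) (auto simp: A'_def)
  also have "\<dots> = Q * ?D * Q\<^sup>T"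
    unfolding Q_def mat_diag_Suc eq' using P'(2)
    by (simp add: transpose_four_block_mat[of _ 1 1 _ n _ n] mult_block_diag mult_carrier_mat[of _ n n]
      del: One_nat_def)
  finally have MQ: "M = Q * ?D * Q\<^sup>T" .
  have "P * M * P\<^sup>T = (P * P\<^sup>T) * A * (P * P\<^sup>T)"
    unfolding M_def using P(2) A by (simp add: square_mat_simps[where n = "Suc n"])
  then have "A = P * M * P\<^sup>T" using P(4) A by simp
  also have "\<dots> = (P * Q) * ?D * (P * Q)\<^sup>T"
    unfolding MQ using P(2) cQ by (simp add: square_mat_simps[where n = "Suc n"])
  finally show ?case using orthogonal_group_mult[OF P(1) Q] by blast
qed

section \<open>Singular value decomposition of a rectangular matrix\<close>

definition rect_diag :: "nat \<Rightarrow> nat \<Rightarrow> (nat \<Rightarrow> 'a :: zero) \<Rightarrow> 'a mat" where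
  "rect_diag p q f = mat p q (\<lambda>(i,j). if i = j then f j else 0)"

lemma rect_diag_carrier [simp]: "rect_diag p q f \<in> carrier_mat p q"
  by (simp add: rect_diag_def)

lemma rect_diag_Suc:
  "rect_diag (Suc p) (Suc q) (case_nat a f) =
    four_block_mat (mat 1 1 (\<lambda>_. a)) (0\<^sub>m 1 q) (0\<^sub>m p 1) (rect_diag p q f)"
  by (rule eq_matI) (auto simp: rect_diag_def split: nat.split)

text \<open>If \<open>v\<close> is an eigenvector of \<open>X^T X\<close>, then \<open>X\<close>
  maps vectors orthogonal to \<open>v\<close> to vectors orthogonal to \<open>X v\<close>. With
  \<open>v\<close> as first column of \<open>Q\<close> and the direction of \<open>X v\<close> as
  first column of \<open>P\<close>, the matrix \<open>P^T X Q\<close> splits off its corner entry.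
  Both dimensions drop together, hence the generalization over \<open>p\<close>. The values
  \<open>s\<close> are neither ordered nor required to be nonnegative.\<close>

theorem real_svd:
  fixes X :: "real mat"
  assumes "X \<in> carrier_mat p q" "q \<le> p"
  shows "\<exists>P\<in>orthogonal_group p. \<exists>Q\<in>orthogonal_group q. \<exists>s. X = P * rect_diag p q s * Q\<^sup>T"
  using assms
proof (induction q arbitrary: p X)
  case 0
  have "1\<^sub>m p \<in> orthogonal_group p" "1\<^sub>m 0 \<in> orthogonal_group 0" by (auto simp: orthogonal_group_def)
  moreover have "X = 1\<^sub>m p * rect_diag p 0 (\<lambda>_. 0) * (1\<^sub>m 0)\<^sup>T"
    using 0 by (intro eq_matI) (auto simp: rect_diag_def)
  ultimately show ?case by blast
next
  case (Suc q p0 X)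
  then obtain p where p0: "p0 = Suc p" and qp: "q \<le> p" by (cases p0) auto
  note X = Suc.prems(1)[unfolded p0]
  let ?p = "Suc p" and ?q = "Suc q"
  have XX: "X\<^sup>T * X \<in> carrier_mat ?q ?q" using X by auto
  have sym: "(X\<^sup>T * X)\<^sup>T = X\<^sup>T * X" using X by (simp add: transpose_mult[of _ ?q ?p _ ?q])
  obtain v l where v: "v \<in> carrier_vec ?q" "v \<bullet> v = 1" and eig: "(X\<^sup>T * X) *\<^sub>v v = l \<cdot>\<^sub>v v"
    using real_symmetric_eigenvector[OF XX sym] by auto
  obtain Q where "Q \<in> orthogonal_group ?q" and Qv: "col Q 0 = v"
    using orthogonal_with_first_col[OF v] by auto
  note Q = this(1) orthogonal_groupD[OF this(1)]
  define Y where "Y = X * Q"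
  have Y: "Y \<in> carrier_mat ?p ?q" using X Q by (auto simp: Y_def)
  have Yj: "col Y j = X *\<^sub>v col Q j" if "j < ?q" for j
    unfolding Y_def using X Q that by (intro col_mult2) auto
  have Y0: "col Y 0 = X *\<^sub>v v" using Yj[of 0] by (simp add: Qv)
  have orth: "col Y 0 \<bullet> col Y j = 0" if j: "0 < j" "j < ?q" for j
  proof -
    have cj: "col Q j \<in> carrier_vec ?q" using Q j by auto
    have "col Y 0 \<bullet> col Y j = (X *\<^sub>v v) \<bullet> (X *\<^sub>v col Q j)"
      unfolding Y0 Yj[OF j(2)] ..
    also have "\<dots> = (X\<^sup>T *\<^sub>v (X *\<^sub>v v)) \<bullet> col Q j"
      using X v cj transpose_vec_mult_scalar[of X ?p ?q "col Q j" "X *\<^sub>v v"] by auto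
    also have "X\<^sup>T *\<^sub>v (X *\<^sub>v v) = l \<cdot>\<^sub>v v" using X v eig by (simp add: assoc_mult_mat_vec[of _ ?q ?p _ ?q])
    also have "(l \<cdot>\<^sub>v v) \<bullet> col Q j = l * (col Q 0 \<bullet> col Q j)" using v cj Qv by simp
    also have "col Q 0 \<bullet> col Q j = (Q\<^sup>T * Q) $$ (0, j)" using Q(2) j by simp
    also have "\<dots> = 0" unfolding Q(3) using j by simp
    finally show ?thesis by simp
  qed
  obtain u s where u: "u \<in> carrier_vec ?p" "u \<bullet> u = 1" and Xv: "col Y 0 = s \<cdot>\<^sub>v u"
    and uY: "\<And>j. 0 < j \<Longrightarrow> j < ?q \<Longrightarrow> u \<bullet> col Y j = 0"
  proof (cases "col Y 0 = 0\<^sub>v ?p")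
    case False
    then obtain s u where su: "u \<in> carrier_vec ?p" "u \<bullet> u = 1" "col Y 0 = s \<cdot>\<^sub>v u" "s \<noteq> 0"
      using real_normalize[of "col Y 0" ?p] Y by (metis carrier_matD(1) col_dim)
    have "u \<bullet> col Y j = 0" if j: "0 < j" "j < ?q" for j
      using orth[OF j] su Y j by (simp add: smult_scalar_prod_distrib[of _ ?p])
    with su show ?thesis by (intro that) auto
  next
    case True
    \<comment> \<open>Here \<open>X v = 0\<close> determines no direction. The other columns of
      \<open>Y\<close> number at most \<open>q < p + 1\<close>, so a unit vector orthogonal to all
      of them exists, and \<open>0\<close> serves as the corner entry.\<close>
    have "card (col Y ` {1..<?q}) \<le> q" using card_image_le[of "{1..<?q}" "col Y"] by simp
    then have "card (col Y ` {1..<?q}) < ?p" using qp by simp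
    moreover have "col Y ` {1..<?q} \<subseteq> carrier_vec ?p" using Y by auto
    ultimately obtain y where y: "y \<in> carrier_vec ?p" "y \<noteq> 0\<^sub>v ?p"
      "\<And>r. r \<in> col Y ` {1..<?q} \<Longrightarrow> r \<bullet> y = 0"
      using exists_orthogonal_vec[of "col Y ` {1..<?q}" ?p] by blast
    obtain s u where su: "u \<in> carrier_vec ?p" "u \<bullet> u = 1" "y = s \<cdot>\<^sub>v u" "s \<noteq> 0"
      using real_normalize[OF y(1,2)] by metis
    have "u \<bullet> col Y j = 0" if j: "0 < j" "j < ?q" for j
    proof -
      have "s * (col Y j \<bullet> u) = 0" using y(3)[of "col Y j"] su Y j by auto
      then show ?thesis using su Y j by (simp add: comm_scalar_prod[of _ ?p])
    qed
    moreover have "col Y 0 = 0 \<cdot>\<^sub>v u" using True su by auto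
    ultimately show ?thesis using su(1,2) by (intro that)
  qed
  obtain P where "P \<in> orthogonal_group ?p" and Pu: "col P 0 = u"
    using orthogonal_with_first_col[OF u] by auto
  note P = this(1) orthogonal_groupD[OF this(1)]
  define M where "M = P\<^sup>T * Y"
  have M: "M \<in> carrier_mat ?p ?q" using P Y by (auto simp: M_def)
  have M_entry: "M $$ (i, j) = col P i \<bullet> col Y j" if "i < ?p" "j < ?q" for i j
    using that P Y by (simp add: M_def)
  have M0: "M $$ (i, 0) = (if i = 0 then s else 0)" if i: "i < ?p" for i
  proof -
    have "M $$ (i, 0) = s * (col P i \<bullet> col P 0)"
      using i P u by (simp add: M_entry Xv Pu)
    also have "col P i \<bullet> col P 0 = (P\<^sup>T * P) $$ (i, 0)" using P(2) i by simp
    also have "\<dots> = (if i = 0 then 1 else 0)" unfolding P(3) using i by simp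
    finally show ?thesis by simp
  qed
  have M0': "M $$ (0, j) = (if j = 0 then s else 0)" if j: "j < ?q" for j
    using M0[of 0] uY[OF _ j] j by (cases "j = 0") (auto simp: M_entry Pu)
  define X' where "X' = mat p q (\<lambda>(i,j). M $$ (Suc i, Suc j))"
  have X': "X' \<in> carrier_mat p q" by (simp add: X'_def)
  obtain P' Q' s' where P'o: "P' \<in> orthogonal_group p" and Q'o: "Q' \<in> orthogonal_group q"
    and eq': "X' = P' * rect_diag p q s' * Q'\<^sup>T"
    using Suc.IH[OF X' qp] by blast
  note P' = orthogonal_groupD[OF P'o] and Q' = orthogonal_groupD[OF Q'o]
  define P1 where "P1 = four_block_mat (1\<^sub>m 1) (0\<^sub>m 1 p) (0\<^sub>m p 1) P'"
  define Q1 where "Q1 = four_block_mat (1\<^sub>m 1) (0\<^sub>m 1 q) (0\<^sub>m q 1) Q'"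
  have P1: "P1 \<in> orthogonal_group ?p" and Q1: "Q1 \<in> orthogonal_group ?q"
    unfolding P1_def Q1_def by (intro orthogonal_group_block_one P'o Q'o)+
  have cP1: "P1 \<in> carrier_mat ?p ?p" and cQ1: "Q1 \<in> carrier_mat ?q ?q"
    using orthogonal_groupD[OF P1] orthogonal_groupD[OF Q1] by auto
  let ?D = "rect_diag ?p ?q (case_nat s s')"
  have "M = four_block_mat (mat 1 1 (\<lambda>_. s)) (0\<^sub>m 1 q) (0\<^sub>m p 1) X'"
    using M M0 M0' by (intro eq_matI) (auto simp: X'_def)
  also have "\<dots> = P1 * ?D * Q1\<^sup>T"
  proof -
    have c: "P' * rect_diag p q s' \<in> carrier_mat p q" using P'(1) by auto
    have "P1 * ?D = four_block_mat (mat 1 1 (\<lambda>_. s)) (0\<^sub>m 1 q) (0\<^sub>m p 1) (P' * rect_diag p q s')"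
      unfolding P1_def rect_diag_Suc using P'(1) c
      by (subst mult_four_block_mat[of _ 1 1 _ p _ p _ _ 1 _ q])
        (auto simp: left_mult_zero_mat[of _ p] right_mult_zero_mat[of _ p p] left_mult_zero_mat[of _ 1]
          right_mult_zero_mat[of _ p 1] left_mult_one_mat[of _ 1 1]
            left_mult_one_mat[of _ 1 q] left_mult_zero_mat[of _ p q] left_add_zero_mat[of _ p q]
              simp del: One_nat_def)
    also have "\<dots> * Q1\<^sup>T = four_block_mat (mat 1 1 (\<lambda>_. s)) (0\<^sub>m 1 q) (0\<^sub>m p 1) (P' * rect_diag p q s' * Q'\<^sup>T)"
      unfolding Q1_def using Q'(1) c
      by (subst transpose_four_block_mat[of _ 1 1 _ q _ q], auto, subst mult_four_block_mat[of _ 1 1 _ q _ p _ _ 1 _ q])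
        (auto simp: left_mult_zero_mat[of _ q] right_mult_zero_mat[of _ p q] left_add_zero_mat[of _ p q]
          simp del: One_nat_def)
    finally show ?thesis unfolding eq' by simp
  qed
  finally have MQ: "M = P1 * ?D * Q1\<^sup>T" .
  have D: "?D \<in> carrier_mat ?p ?q" by simp
  have "P * M * Q\<^sup>T = (P * P\<^sup>T) * (X * (Q * Q\<^sup>T))"
    unfolding M_def Y_def using P(2) Q(2) X
    by (simp add: assoc_mult_mat[of _ ?p ?p _ ?p _ ?q] assoc_mult_mat[of _ ?p ?p _ ?q _ ?q]
        assoc_mult_mat[of _ ?p ?q _ ?q _ ?q] mult_carrier_mat[of _ ?p ?p _ ?q]
          mult_carrier_mat[of _ ?p ?q _ ?q])
  then have "X = P * M * Q\<^sup>T" using P(4) Q(4) X by simp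
  also have "\<dots> = (P * P1) * ?D * (Q * Q1)\<^sup>T"
    unfolding MQ using P(2) cP1 Q(2) cQ1 D
    by (simp add: transpose_mult[of _ ?q ?q _ ?q] mult_carrier_mat[of _ ?p ?p _ ?q]
      mult_carrier_mat[of _ ?p ?q _ ?q] mult_carrier_mat[of _ ?p ?p _ ?p] mult_carrier_mat[of _ ?q ?q _ ?q]
        assoc_mult_mat[of _ ?p ?p _ ?q _ ?q] assoc_mult_mat[of _ ?p ?p _ ?p _ ?q]
          assoc_mult_mat[of _ ?p ?q _ ?q _ ?q])
  finally show ?case
    unfolding p0 using orthogonal_group_mult[OF P(1) P1] orthogonal_group_mult[OF Q(1) Q1] by blast
qed

section \<open>Simultaneous diagonalization by congruence\<close>

lemma index_congruence_diag:
  fixes T :: "'a :: comm_semiring_0 mat"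
  assumes "T \<in> carrier_mat n n" "j < n" "k < n"
  shows "(T\<^sup>T * mat_diag n d * T) $$ (j, k) = (\<Sum>i<n. d i * (T $$ (i, j) * T $$ (i, k)))"
proof -
  have "T\<^sup>T * mat_diag n d = mat n n (\<lambda>(i,j). T\<^sup>T $$ (i,j) * d j)"
    using assms by (intro mat_diag_mult_right) auto
  then show ?thesis
    using assms by (auto simp: scalar_prod_def atLeast0LessThan ac_simps intro!: sum.cong)
qed

lemma quadratic_form_congruence_diag:
  fixes T :: "real mat"
  assumes T: "T \<in> carrier_mat n n" and y: "y \<in> carrier_vec n"
  shows "y \<bullet> ((T\<^sup>T * mat_diag n d * T) *\<^sub>v y) = (\<Sum>k<n. d k * ((T *\<^sub>v y) $ k)\<^sup>2)"
proof -
  define z where "z = T *\<^sub>v y"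
  have z: "z \<in> carrier_vec n" using T y by (simp add: z_def)
  have e: "(T\<^sup>T * mat_diag n d * T) *\<^sub>v y = T\<^sup>T *\<^sub>v (mat_diag n d *\<^sub>v z)"
    unfolding z_def using T y by (simp add: assoc_mult_mat_vec[of _ n n _ n] mult_carrier_mat[of _ n n _ n])
  have "y \<bullet> ((T\<^sup>T * mat_diag n d * T) *\<^sub>v y) = (T\<^sup>T *\<^sub>v (mat_diag n d *\<^sub>v z)) \<bullet> y"
    unfolding e using T y z by (intro comm_scalar_prod[of _ n]) (auto intro!: mult_mat_vec_carrier[of _ n n])
  also have "\<dots> = (mat_diag n d *\<^sub>v z) \<bullet> z"
    unfolding z_def using T y
    by (intro transpose_vec_mult_scalar) (auto intro!: mult_mat_vec_carrier[of _ n n])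
  also have "mat_diag n d *\<^sub>v z = vec n (\<lambda>k. d k * z $ k)"
    using z by (intro eq_vecI)
      (auto simp: mat_diag_def scalar_prod_def atLeast0LessThan if_distrib[of "\<lambda>x. x * _"] cong: if_cong)
  also have "vec n (\<lambda>k. d k * z $ k) \<bullet> z = (\<Sum>k<n. d k * (z $ k)\<^sup>2)"
    using z by (simp add: scalar_prod_def atLeast0LessThan power2_eq_square ac_simps)
  finally show ?thesis by (simp add: z_def)
qed

text \<open>Otherwise fewer than \<open>n\<close> linear conditions force \<open>y\<close> to vanish where \<open>a \<le> 0\<close> and \<open>T y\<close> to
  vanish where \<open>b > 0\<close>, and a nonzero such \<open>y\<close> makes the left form positive, the right one not.\<close>

lemma sylvester_inertia_le:
  fixes T :: "real mat"
  assumes T: "T \<in> carrier_mat n n"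
    and eq: "\<And>y. y \<in> carrier_vec n \<Longrightarrow> (\<Sum>k<n. a k * (y $ k)\<^sup>2) = (\<Sum>k<n. b k * ((T *\<^sub>v y) $ k)\<^sup>2)"
  shows "card {k. k < n \<and> 0 < a k} \<le> card {k. k < n \<and> 0 < b k}"
proof (rule ccontr)
  let ?A = "{k. k < n \<and> 0 < a k}" and ?A' = "{k. k < n \<and> a k \<le> 0}" and ?B = "{k. k < n \<and> 0 < b k}"
  define R where "R = unit_vec n ` ?A' \<union> row T ` ?B"
  assume "\<not> card ?A \<le> card ?B"
  moreover have "card ?A + card ?A' = card {..<n}"
    by (subst card_Un_disjoint[symmetric]) (auto intro!: arg_cong[of _ "{..<n}" card] simp del: card_lessThan)
  moreover have "card R \<le> card ?A' + card ?B"
    unfolding R_def by (intro order.trans[OF card_Un_le] add_mono card_image_le) auto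
  ultimately have "card R < n" by simp
  moreover have "R \<subseteq> carrier_vec n" using T by (auto simp: R_def)
  moreover have "finite R" by (simp add: R_def)
  ultimately obtain y where y: "y \<in> carrier_vec n" "y \<noteq> 0\<^sub>v n" and yR: "\<And>r. r \<in> R \<Longrightarrow> r \<bullet> y = 0"
    using exists_orthogonal_vec[of R n] by metis
  have y0: "y $ k = 0" if "k < n" "a k \<le> 0" for k
    using yR[of "unit_vec n k"] that y(1) by (auto simp: R_def)
  have Ty0: "(T *\<^sub>v y) $ k = 0" if "k < n" "0 < b k" for k
    using yR[of "row T k"] that T by (auto simp: R_def)
  obtain m where m: "m < n" "y $ m \<noteq> 0" using y by (metis eq_vecI carrier_vecD index_zero_vec)
  then have "0 < a m * (y $ m)\<^sup>2" using y0[of m] by force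
  also have "\<dots> \<le> (\<Sum>k<n. a k * (y $ k)\<^sup>2)"
    using m y0 by (intro member_le_sum) (auto, metis linorder_not_le less_eq_real_def mult_nonneg_nonneg mult_zero_right power_zero_numeral zero_le_power2)
  also have "\<dots> = (\<Sum>k<n. b k * ((T *\<^sub>v y) $ k)\<^sup>2)" by (rule eq[OF y(1)])
  also have "\<dots> \<le> 0"
  proof (rule sum_nonpos)
    fix k assume "k \<in> {..<n}"
    then show "b k * ((T *\<^sub>v y) $ k)\<^sup>2 \<le> 0"
      using Ty0[of k] by (cases "0 < b k") (auto simp: mult_nonpos_nonneg)
  qed
  finally show False by simp
qed

text \<open>Right-nesting hides an inverse pair inside \<open>A * (B * X)\<close>; this form lets
  the simplifier cancel it there.\<close>

lemma inverse_pair_cancel: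
  fixes A :: "'a :: semiring_1 mat"
  assumes "A \<in> carrier_mat n n" "B \<in> carrier_mat n n" "X \<in> carrier_mat n m" "A * B = 1\<^sub>m n"
  shows "A * (B * X) = X"
  using assms by (simp add: assoc_mult_mat[symmetric, of A n n B n X m])

lemma mat_diag_transpose [simp]: "(mat_diag n f)\<^sup>T = mat_diag n f"
  by (rule eq_matI) (auto simp: mat_diag_def)

lemma mat_diag_mult_vec:
  fixes a :: "nat \<Rightarrow> 'a :: semiring_0"
  assumes "y \<in> carrier_vec n"
  shows "mat_diag n a *\<^sub>v y = vec n (\<lambda>k. a k * y $ k)"
  using assms by (intro eq_vecI)
    (auto simp: mat_diag_def scalar_prod_def atLeast0LessThan if_distrib[of "\<lambda>x. x * _"] cong: if_cong)

text \<open>The value of the quadratic form at column \<open>i\<close> of \<open>P\<close> is the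
  eigenvalue \<open>f i\<close>.\<close>

lemma pos_def_diagonalize:
  fixes A :: "real mat"
  assumes A: "A \<in> carrier_mat n n" and sym: "A\<^sup>T = A"
    and pos: "\<And>x. x \<in> carrier_vec n \<Longrightarrow> x \<noteq> 0\<^sub>v n \<Longrightarrow> 0 < x \<bullet> (A *\<^sub>v x)"
  obtains P f where "P \<in> orthogonal_group n" "A = P * mat_diag n f * P\<^sup>T" "\<And>i. i < n \<Longrightarrow> 0 < f i"
proof -
  obtain P f where Po: "P \<in> orthogonal_group n" and eq: "A = P * mat_diag n f * P\<^sup>T"
    using real_spectral[OF A sym] by auto
  note P = orthogonal_groupD[OF Po]
  have PT: "P\<^sup>T \<in> carrier_mat n n" using P by simp
  have "0 < f i" if i: "i < n" for i
  proof -
    let ?x = "col P i"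
    have x: "?x \<in> carrier_vec n" using P i by auto
    have Px: "P\<^sup>T *\<^sub>v ?x = unit_vec n i"
    proof -
      have "P\<^sup>T *\<^sub>v ?x = col (P\<^sup>T * P) i"
        using P(1) i by (intro col_mult2[symmetric]) auto
      then show ?thesis unfolding P(2) using i by simp
    qed
    have "?x \<noteq> 0\<^sub>v n"
    proof
      assume "?x = 0\<^sub>v n"
      moreover have "P\<^sup>T *\<^sub>v 0\<^sub>v n = 0\<^sub>v n" by (rule mult_mat_zero_vec[OF PT])
      ultimately have "unit_vec n i = (0\<^sub>v n :: real vec)" using Px by simp
      then show False using i by simp
    qed
    then have "0 < ?x \<bullet> (A *\<^sub>v ?x)" using pos x by blast
    also have "?x \<bullet> (A *\<^sub>v ?x) = (\<Sum>k<n. f k * ((P\<^sup>T *\<^sub>v ?x) $ k)\<^sup>2)"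
      using quadratic_form_congruence_diag[OF PT x, of f] by (simp add: eq)
    also have "\<dots> = f i"
      unfolding Px using i by (simp add: power2_eq_square if_distrib[of "\<lambda>x. _ * x"] cong: if_cong)
    finally show ?thesis .
  qed
  with Po eq show thesis by (intro that)
qed

text \<open>As no \<open>a k\<close> vanishes, the two counts for \<open>a\<close> add up to
  \<open>n\<close>, while those for \<open>e\<close> add up to at most \<open>n\<close>. Both
  inequalities are therefore equalities and no \<open>e k\<close> vanishes; bijections between the
  positive and between the negative indices are glued together.\<close>

lemma ex_sign_matching_permutation:
  fixes a e :: "nat \<Rightarrow> real"
  assumes pos: "card {k. k < n \<and> 0 < a k} \<le> card {k. k < n \<and> 0 < e k}"
    and neg: "card {k. k < n \<and> a k < 0} \<le> card {k. k < n \<and> e k < 0}"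
    and a: "\<And>k. k < n \<Longrightarrow> a k \<noteq> 0"
  obtains \<pi> where "bij_betw \<pi> {..<n} {..<n}" "\<And>k. k < n \<Longrightarrow> sgn (e (\<pi> k)) = sgn (a k)"
proof -
  let ?P = "\<lambda>f. {k. k < n \<and> 0 < (f k :: real)}" and ?N = "\<lambda>f. {k. k < n \<and> (f k :: real) < 0}"
    and ?Z = "{k. k < n \<and> e k = 0}"
  have "card (?P a) + card (?N a) = card (?P a \<union> ?N a)"
    by (rule card_Un_disjoint[symmetric]) auto
  also have "?P a \<union> ?N a = {..<n}" using a by (auto simp: not_less less_le)
  finally have A: "card (?P a) + card (?N a) = n" by simp
  have "card (?P e) + card (?N e) + card ?Z = card ((?P e \<union> ?N e) \<union> ?Z)"
    by (subst card_Un_disjoint; (subst card_Un_disjoint)?) auto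
  also have "(?P e \<union> ?N e) \<union> ?Z = {..<n}" by auto
  finally have E: "card (?P e) + card (?N e) + card ?Z = n" by simp
  have cP: "card (?P a) = card (?P e)" and cN: "card (?N a) = card (?N e)" and "card ?Z = 0"
    using A E pos neg by linarith+
  then have Z: "?Z = {}" by simp
  obtain f where f: "bij_betw f (?P a) (?P e)"
    using cP finite_same_card_bij[of "?P a" "?P e"] by auto
  obtain g where g: "bij_betw g (?N a) (?N e)"
    using cN finite_same_card_bij[of "?N a" "?N e"] by auto
  define \<pi> where "\<pi> k = (if 0 < a k then f k else g k)" for k
  have "bij_betw \<pi> (?P a) (?P e) = bij_betw f (?P a) (?P e)"
    by (intro bij_betw_cong) (auto simp: \<pi>_def)
  then have f': "bij_betw \<pi> (?P a) (?P e)" using f by simp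
  have "bij_betw \<pi> (?N a) (?N e) = bij_betw g (?N a) (?N e)"
    by (intro bij_betw_cong) (auto simp: \<pi>_def)
  then have g': "bij_betw \<pi> (?N a) (?N e)" using g by simp
  have "bij_betw \<pi> (?P a \<union> ?N a) (?P e \<union> ?N e)"
    by (rule bij_betw_combine[OF f' g']) auto
  moreover have "?P a \<union> ?N a = {..<n}" using a by (auto simp: not_less less_le)
  moreover have "?P e \<union> ?N e = {..<n}" using Z by (auto simp: not_less less_le)
  ultimately have "bij_betw \<pi> {..<n} {..<n}" by simp
  moreover have "sgn (e (\<pi> k)) = sgn (a k)" if "k < n" for k
  proof (cases "0 < a k")
    case True
    then have "\<pi> k \<in> ?P e" using bij_betwE[OF f'] that by auto
    with True show ?thesis by simp
  next
    case False
    then have "a k < 0" using a[OF that] by linarith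
    then have "\<pi> k \<in> ?N e" using bij_betwE[OF g'] that by auto
    with \<open>a k < 0\<close> show ?thesis by simp
  qed
  ultimately show thesis by (rule that)
qed

text \<open>In coordinates where \<open>A\<close> is the identity, an orthogonal change of basis
  diagonalizes the second form and keeps the first. This gives \<open>A = T0^T T0\<close> and a
  diagonal \<open>e\<close> in place of \<open>a\<close>. By inertia \<open>e\<close> has the signs
  of \<open>a\<close> up to a permutation, and since the entries of \<open>a\<close> are 1 or -1,
  rescaling the coordinates turns \<open>e\<close> into \<open>a\<close>, at the price of a positive
  diagonal in \<open>A\<close>.\<close>

theorem simultaneous_congruence:
  fixes A :: "real mat"
  assumes A: "A \<in> carrier_mat n n" and sym: "A\<^sup>T = A"
    and pos: "\<And>x. x \<in> carrier_vec n \<Longrightarrow> x \<noteq> 0\<^sub>v n \<Longrightarrow> 0 < x \<bullet> (A *\<^sub>v x)"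
    and a: "\<And>k. k < n \<Longrightarrow> \<bar>a k\<bar> = 1"
  obtains T d where "T \<in> carrier_mat n n" "T\<^sup>T * mat_diag n a * T = mat_diag n a"
    "A = T\<^sup>T * mat_diag n d * T" "\<And>k. k < n \<Longrightarrow> 0 < d k"
proof -
  obtain P f where Po: "P \<in> orthogonal_group n" and AP: "A = P * mat_diag n f * P\<^sup>T"
    and f: "\<And>i. i < n \<Longrightarrow> 0 < f i"
    using pos_def_diagonalize[OF A sym pos] by blast
  note P = orthogonal_groupD[OF Po]
  let ?J = "mat_diag n a"
  define r where "r k = sqrt (f k)" for k
  \<comment> \<open>\<open>L\<close> is a square root of \<open>A\<close> in the sense
    \<open>L^T L = A\<close>, and \<open>K\<close> is its inverse.\<close>
  define L where "L = mat_diag n r * P\<^sup>T"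
  define K where "K = P * mat_diag n (\<lambda>k. 1 / r k)"
  have L: "L \<in> carrier_mat n n" and K: "K \<in> carrier_mat n n" using P by (auto simp: L_def K_def intro!: mult_carrier_mat[of _ n n _ n])
  have r: "r k \<noteq> 0" if "k < n" for k using f[OF that] by (simp add: r_def)
  have "mat_diag n (\<lambda>k. 1 / r k * r k) = mat_diag n (\<lambda>k. 1)"
    using r by (intro eq_matI) (auto simp: mat_diag_def)
  then have "K * L = 1\<^sub>m n"
    using P by (simp add: K_def L_def square_mat_simps[where n = n] inverse_pair_cancel[of _ n _ _ n])
  then have KL: "K * L = 1\<^sub>m n" "L\<^sup>T * K\<^sup>T = 1\<^sub>m n"
    using transpose_mult[OF K L] by auto
  have "mat_diag n (\<lambda>k. r k * r k) = mat_diag n f"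
    using f by (intro eq_matI) (auto simp: mat_diag_def r_def less_imp_le)
  then have AL: "A = L\<^sup>T * L"
    using P by (simp add: AP L_def square_mat_simps[where n = n])
       (simp add: assoc_mult_mat[symmetric, of _ n n _ n _ n])
  \<comment> \<open>\<open>G\<close> expresses the form \<open>?J\<close> in the coordinates in
    which \<open>A\<close> is the identity.\<close>
  define G where "G = K\<^sup>T * (?J * K)"
  have G: "G \<in> carrier_mat n n" "G\<^sup>T = G"
    using K by (auto simp: G_def square_mat_simps[where n = n])
  obtain W e where Wo: "W \<in> orthogonal_group n" and GW: "G = W * mat_diag n e * W\<^sup>T"
    using real_spectral[OF G] by auto
  note W = orthogonal_groupD[OF Wo]
  define T0 where "T0 = W\<^sup>T * L"
  have T0: "T0 \<in> carrier_mat n n" using W L by (auto simp: T0_def)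
  have JT0: "?J = T0\<^sup>T * mat_diag n e * T0"
  proof -
    have "T0\<^sup>T * mat_diag n e * T0 = L\<^sup>T * (G * L)"
      using W L by (simp add: T0_def GW square_mat_simps[where n = n])
    also have "\<dots> = ?J"
      using K L KL by (simp add: G_def square_mat_simps[where n = n] inverse_pair_cancel[of _ n _ _ n])
    finally show ?thesis ..
  qed
  have AT0: "A = T0\<^sup>T * mat_diag n (\<lambda>_. 1) * T0"
    using W L by (simp add: T0_def AL square_mat_simps[where n = n] inverse_pair_cancel[of _ n _ _ n])
  have form: "(\<Sum>k<n. a k * (y $ k)\<^sup>2) = (\<Sum>k<n. e k * ((T0 *\<^sub>v y) $ k)\<^sup>2)" if y: "y \<in> carrier_vec n" for y
  proof -
    have "(\<Sum>k<n. a k * (y $ k)\<^sup>2) = y \<bullet> (?J *\<^sub>v y)"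
      using y by (simp add: mat_diag_mult_vec scalar_prod_def atLeast0LessThan power2_eq_square ac_simps)
    then show ?thesis unfolding JT0 quadratic_form_congruence_diag[OF T0 y] .
  qed
  have a0: "a k \<noteq> 0" if "k < n" for k using a[OF that] by auto
  have pos_le: "card {k. k < n \<and> 0 < a k} \<le> card {k. k < n \<and> 0 < e k}"
    by (rule sylvester_inertia_le[OF T0 form])
  \<comment> \<open>Negating both forms turns the bound for positive entries into the one for
    negative entries.\<close>
  have "card {k. k < n \<and> 0 < - a k} \<le> card {k. k < n \<and> 0 < - e k}"
    by (rule sylvester_inertia_le[OF T0]) (use form in \<open>simp add: sum_negf\<close>)
  then have neg_le: "card {k. k < n \<and> a k < 0} \<le> card {k. k < n \<and> e k < 0}" by simp
  obtain \<pi> where \<pi>: "bij_betw \<pi> {..<n} {..<n}" and sgn: "\<And>k. k < n \<Longrightarrow> sgn (e (\<pi> k)) = sgn (a k)"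
    using ex_sign_matching_permutation[OF pos_le neg_le a0] by blast
  define c where "c k = \<bar>e (\<pi> k)\<bar>" for k
  have c: "0 < c k" "a k * c k = e (\<pi> k)" if "k < n" for k
  proof -
    show "0 < c k" using sgn[OF that] a0[OF that] by (auto simp: c_def sgn_0_0)
    have "a k = sgn (a k)" using a[OF that] by (auto simp: sgn_if abs_if split: if_splits)
    also have "\<dots> = sgn (e (\<pi> k))" using sgn[OF that] by simp
    finally have "a k * c k = sgn (e (\<pi> k)) * \<bar>e (\<pi> k)\<bar>" unfolding c_def by (rule arg_cong)
    then show "a k * c k = e (\<pi> k)" by (simp only: sgn_mult_abs)
  qed
  \<comment> \<open>The rows of \<open>T0\<close> are permuted by \<pi> and row \<open>i\<close> is
    scaled by \<open>sqrt (c i)\<close>, so a weight \<open>g i\<close> on \<open>T\<close> acts as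
    the weight \<open>g i * c i\<close> on row \<open>\<pi> i\<close> of \<open>T0\<close>. The two
    pairs needed are \<open>a\<close> with \<open>e\<close>, and \<open>1 / c\<close> with the
    constant 1.\<close>
  define T where "T = mat n n (\<lambda>(i,j). sqrt (c i) * T0 $$ (\<pi> i, j))"
  have T: "T \<in> carrier_mat n n" by (simp add: T_def)
  have reindex: "T\<^sup>T * mat_diag n g * T = T0\<^sup>T * mat_diag n h * T0"
    if gh: "\<And>i. i < n \<Longrightarrow> g i * c i = h (\<pi> i)" for g h
  proof (rule eq_matI)
    fix j k assume "j < dim_row (T0\<^sup>T * mat_diag n h * T0)" "k < dim_col (T0\<^sup>T * mat_diag n h * T0)"
    then have jk: "j < n" "k < n" using T0 by auto
    have "(\<Sum>i<n. g i * (T $$ (i, j) * T $$ (i, k))) = (\<Sum>i<n. h (\<pi> i) * (T0 $$ (\<pi> i, j) * T0 $$ (\<pi> i, k)))"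
    proof (rule sum.cong)
      fix i assume "i \<in> {..<n}"
      then have i: "i < n" by simp
      have "g i * (T $$ (i, j) * T $$ (i, k)) =
          g i * (sqrt (c i) * sqrt (c i)) * (T0 $$ (\<pi> i, j) * T0 $$ (\<pi> i, k))"
        using i jk by (simp add: T_def)
      also have "sqrt (c i) * sqrt (c i) = c i" using c(1)[OF i] by simp
      finally show "g i * (T $$ (i, j) * T $$ (i, k)) = h (\<pi> i) * (T0 $$ (\<pi> i, j) * T0 $$ (\<pi> i, k))"
        unfolding gh[OF i] .
    qed simp
    also have "\<dots> = (\<Sum>i<n. h i * (T0 $$ (i, j) * T0 $$ (i, k)))"
      by (rule sum.reindex_bij_betw[OF \<pi>])
    finally show "(T\<^sup>T * mat_diag n g * T) $$ (j, k) = (T0\<^sup>T * mat_diag n h * T0) $$ (j, k)"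
      using jk by (simp add: index_congruence_diag[OF T] index_congruence_diag[OF T0])
  qed (use T T0 in auto)
  show thesis
  proof (rule that[OF T])
    show "T\<^sup>T * ?J * T = ?J" using reindex[of a e] c(2) JT0 by simp
    show "A = T\<^sup>T * mat_diag n (\<lambda>k. 1 / c k) * T"
      using reindex[of "\<lambda>k. 1 / c k" "\<lambda>_. 1"] c(1) AT0 by (simp add: less_imp_neq[symmetric])
    show "0 < 1 / c k" if "k < n" for k using c(1)[OF that] by simp
  qed
qed

section \<open>Groups preserving the indefinite form\<close>

lemma mat_adjoint_index [simp]:
  "i < dim_col A \<Longrightarrow> j < dim_row A \<Longrightarrow> mat_adjoint A $$ (i, j) = conjugate (A $$ (j, i))"
  by (simp add: mat_adjoint_def mat_of_rows_index)

lemma mat_adjoint_dim [simp]: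
  "dim_row (mat_adjoint A) = dim_col A" "dim_col (mat_adjoint A) = dim_row A"
  by (simp_all add: mat_adjoint_def)

lemma mat_adjoint_carrier [simp]: "mat_adjoint A \<in> carrier_mat n m \<longleftrightarrow> A \<in> carrier_mat m n"
  unfolding carrier_mat_def by auto

lemma mat_adjoint_mult:
  fixes A B :: "complex mat"
  assumes "A \<in> carrier_mat n m" "B \<in> carrier_mat m l"
  shows "mat_adjoint (A * B) = mat_adjoint B * mat_adjoint A"
  using assms by (intro eq_matI) (auto simp: scalar_prod_def conjugate_complex_def mult.commute intro!: sum.cong)

lemma mat_adjoint_four_block_mat:
  fixes A B C D :: "complex mat"
  assumes "A \<in> carrier_mat n1 m1" "B \<in> carrier_mat n1 m2" "C \<in> carrier_mat n2 m1" "D \<in> carrier_mat n2 m2"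
  shows "mat_adjoint (four_block_mat A B C D) =
    four_block_mat (mat_adjoint A) (mat_adjoint C) (mat_adjoint B) (mat_adjoint D)"
  using assms by (intro eq_matI) auto

abbreviation complexify :: "real mat \<Rightarrow> complex mat" where
  "complexify \<equiv> map_mat complex_of_real"

lemma mat_adjoint_complexify: "mat_adjoint (complexify A) = complexify A\<^sup>T"
  by (intro eq_matI) auto

text \<open>As a single diagonal matrix, the form multiplies rows or columns by signs, which makes
  products with it readable entry by entry.\<close>

lemma indef_mat_eq_mat_diag: "indef_mat p q = mat_diag (p + q) (\<lambda>i. if i < p then 1 else - 1)"
  by (rule eq_matI) (auto simp: indef_mat_def mat_diag_def)

lemma indef_mat_carrier [simp]: "indef_mat p q \<in> carrier_mat (p + q) (p + q)"
  by (simp add: indef_mat_eq_mat_diag)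

lemma indef_mat_square [simp]: "indef_mat p q * indef_mat p q = (1\<^sub>m (p + q) :: 'a :: ring_1 mat)"
proof -
  have "mat_diag (p + q) (\<lambda>i. (if i < p then 1 else - 1) * (if i < p then 1 else - 1)) = (1\<^sub>m (p + q) :: 'a mat)"
    by (rule eq_matI) (auto simp: mat_diag_def)
  then show ?thesis by (simp add: indef_mat_eq_mat_diag)
qed

lemma indef_mat_transpose [simp]: "(indef_mat p q)\<^sup>T = indef_mat p q"
  by (simp add: indef_mat_eq_mat_diag)

lemma complexify_indef_mat [simp]: "complexify (indef_mat p q) = indef_mat p q"
  by (rule eq_matI) (auto simp: indef_mat_eq_mat_diag mat_diag_def)

lemma mat_adjoint_indef_mat [simp]: "mat_adjoint (indef_mat p q :: complex mat) = indef_mat p q"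
  by (rule eq_matI) (auto simp: indef_mat_eq_mat_diag mat_diag_def)

text \<open>\<open>J * (G' * J * G) = J * J = 1\<close> exhibits \<open>J * G' * J\<close> as a left
  inverse of \<open>G\<close>, hence a two-sided one, and reading it from the other side gives
  \<open>G * J * G' = J\<close>. With \<open>G'\<close> arbitrary, the lemma serves both the
  transpose and the adjoint.\<close>

lemma form_preserving_inverse:
  fixes G G' J :: "'a :: field mat"
  assumes "G \<in> carrier_mat n n" "G' \<in> carrier_mat n n" "J \<in> carrier_mat n n"
    and "J * J = 1\<^sub>m n" "G' * J * G = J"
  shows "(J * G' * J) * G = 1\<^sub>m n" "G * (J * G' * J) = 1\<^sub>m n" "G * J * G' = J"
proof -
  have c: "J * G' * J \<in> carrier_mat n n" using assms by (simp add: square_mat_simps[where n = n])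
  have "J * (G' * J * G) = 1\<^sub>m n" using assms by simp
  then show 1: "(J * G' * J) * G = 1\<^sub>m n" using assms(1-3) by (simp add: square_mat_simps[where n = n])
  show 2: "G * (J * G' * J) = 1\<^sub>m n" by (rule mat_mult_left_right_inverse[OF c assms(1) 1])
  have "(G * J * G') * (J * J) = (G * (J * G' * J)) * J"
    using assms(1-3) by (simp add: square_mat_simps[where n = n])
  also have "\<dots> = J" unfolding 2 using assms by simp
  finally show "G * J * G' = J" using assms by (simp add: square_mat_simps[where n = n])
qed

lemma indef_unitary_groupD:
  assumes "U \<in> indef_unitary_group p q"
  defines "J \<equiv> indef_mat p q"
  shows "U \<in> carrier_mat (p + q) (p + q)" "mat_adjoint U * J * U = J" "U * J * mat_adjoint U = J"
    "(J * mat_adjoint U * J) * U = 1\<^sub>m (p + q)" "U * (J * mat_adjoint U * J) = 1\<^sub>m (p + q)"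
  using assms form_preserving_inverse[of U "p + q" "mat_adjoint U" J]
  by (auto simp: indef_unitary_group_def)

lemma indef_orthogonal_groupD:
  assumes "G \<in> indef_orthogonal_group p q"
  defines "J \<equiv> indef_mat p q"
  shows "G \<in> carrier_mat (p + q) (p + q)" "G\<^sup>T * J * G = J" "G * J * G\<^sup>T = J"
    "(J * G\<^sup>T * J) * G = 1\<^sub>m (p + q)" "G * (J * G\<^sup>T * J) = 1\<^sub>m (p + q)"
  using assms form_preserving_inverse[of G "p + q" "G\<^sup>T" J]
  by (auto simp: indef_orthogonal_group_def)

lemma indef_orthogonal_group_mult:
  assumes "G \<in> indef_orthogonal_group p q" "H \<in> indef_orthogonal_group p q"
  shows "G * H \<in> indef_orthogonal_group p q"
proof -
  note G = indef_orthogonal_groupD[OF assms(1)] and H = indef_orthogonal_groupD[OF assms(2)]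
  let ?J = "indef_mat p q"
  have "(G * H)\<^sup>T * ?J * (G * H) = H\<^sup>T * (G\<^sup>T * ?J * G) * H"
    using G(1) H(1) by (simp add: square_mat_simps[where n = "p + q"])
  also have "\<dots> = ?J" unfolding G(2) using H(2) .
  finally show ?thesis using G(1) H(1) by (auto simp: indef_orthogonal_group_def)
qed

section \<open>Algebra of the hyperbolic factor\<close>

lemma mult_rect_diag:
  fixes f g h :: "nat \<Rightarrow> 'a :: comm_semiring_1"
  assumes "q \<le> p"
  shows "rect_diag p q f * (rect_diag p q g)\<^sup>T = mat_diag p (\<lambda>i. if i < q then f i * g i else 0)"
    and "(rect_diag p q f)\<^sup>T * rect_diag p q g = mat_diag q (\<lambda>i. f i * g i)"
    and "mat_diag p h * rect_diag p q g = rect_diag p q (\<lambda>i. h i * g i)"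
    and "rect_diag p q f * mat_diag q h = rect_diag p q (\<lambda>i. f i * h i)"
proof -
  show "rect_diag p q f * (rect_diag p q g)\<^sup>T = mat_diag p (\<lambda>i. if i < q then f i * g i else 0)"
    by (rule eq_matI) (auto simp: rect_diag_def mat_diag_def scalar_prod_def if_distrib[of "\<lambda>x. x * _"]
      cong: if_cong)
  show "(rect_diag p q f)\<^sup>T * rect_diag p q g = mat_diag q (\<lambda>i. f i * g i)"
    using assms by (intro eq_matI) (auto simp: rect_diag_def mat_diag_def scalar_prod_def if_distrib[of "\<lambda>x. x * _"] cong: if_cong)
  show "mat_diag p h * rect_diag p q g = rect_diag p q (\<lambda>i. h i * g i)"
    by (subst mat_diag_mult_left[of _ p q]) (auto simp: rect_diag_def intro!: eq_matI)
  show "rect_diag p q f * mat_diag q h = rect_diag p q (\<lambda>i. f i * h i)"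
    by (subst mat_diag_mult_right[of _ p q]) (auto simp: rect_diag_def intro!: eq_matI)
qed

lemma append_cols_dim [simp]:
  "dim_row (A @\<^sub>c B) = dim_row A" "dim_col (A @\<^sub>c B) = dim_col A + dim_col B"
  by (simp_all add: append_cols_def)

lemma append_rows_dim [simp]:
  "dim_row (A @\<^sub>r B) = dim_row A + dim_row B" "dim_col (A @\<^sub>r B) = dim_col A"
  by (simp_all add: append_rows_def)

lemma append_cols_index:
  "i < dim_row A \<Longrightarrow> j < dim_col A + dim_col B \<Longrightarrow>
    (A @\<^sub>c B) $$ (i, j) = (if j < dim_col A then A $$ (i, j) else B $$ (i, j - dim_col A))"
  by (simp add: append_cols_def)

lemma append_rows_index:
  "i < dim_row A + dim_row B \<Longrightarrow> j < dim_col A \<Longrightarrow>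
    (A @\<^sub>r B) $$ (i, j) = (if i < dim_row A then A $$ (i, j) else B $$ (i - dim_row A, j))"
  by (simp add: append_rows_def)

text \<open>Regroups the three block rows and columns into two of sizes \<open>p\<close> and
  \<open>q\<close>, matching \<open>indef_mat\<close> and the block diagonal factors. The middle
  identity joins the upper \<open>Ch\<close>, and \<open>i Sh\<close> together with the
  \<open>p - q\<close> zero rows below it is a \<open>rect_diag\<close>.\<close>

lemma hyperbolic_mat_blocks:
  assumes qp: "q \<le> p"
  shows "hyperbolic_mat p q \<theta> = four_block_mat
    (mat_diag p (\<lambda>i. if i < q then complex_of_real (cosh (\<theta> i)) else 1))
    (rect_diag p q (\<lambda>i. \<i> * complex_of_real (sinh (\<theta> i))))
    ((rect_diag p q (\<lambda>i. - (\<i> * complex_of_real (sinh (\<theta> i)))))\<^sup>T)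
    (mat_diag q (\<lambda>i. complex_of_real (cosh (\<theta> i))))" (is "_ = ?R")
proof (rule eq_matI)
  have dim: "dim_row (mat_diag m f) = m" "dim_col (mat_diag m f) = m"
    "dim_row (rect_diag m k f) = m" "dim_col (rect_diag m k f) = k" for m k and f :: "nat \<Rightarrow> complex"
    by (simp_all add: mat_diag_def rect_diag_def)
  show "dim_row (hyperbolic_mat p q \<theta>) = dim_row ?R" "dim_col (hyperbolic_mat p q \<theta>) = dim_col ?R"
    using qp by (simp_all add: hyperbolic_mat_def Let_def cosh_block_def sinh_block_def dim)
  fix i j assume "i < dim_row ?R" "j < dim_col ?R"
  then have i: "i < p + q" and j: "j < p + q" by (simp_all add: dim)
  have diag: "mat_diag m f $$ (k, l) = (if k = l then f l else 0)" if "k < m" "l < m"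
    for m k l and f :: "nat \<Rightarrow> complex" using that by (simp add: mat_diag_def)
  consider "i < q" | "q \<le> i" "i < p" | "p \<le> i" by linarith
  then show "hyperbolic_mat p q \<theta> $$ (i, j) = ?R $$ (i, j)"
  proof cases
    case 1
    consider "j < q" | "q \<le> j" "j < p" | "p \<le> j" by linarith
    then show ?thesis
      by cases ((use 1 qp i j in \<open>simp_all add: hyperbolic_mat_def Let_def cosh_block_def sinh_block_def dim
        append_rows_index append_cols_index diag rect_diag_def\<close>), (arith+)?)
  next
    case 2
    consider "j < q" | "q \<le> j" "j < p" | "p \<le> j" by linarith
    then show ?thesis
      by cases ((use 2 qp i j in \<open>simp_all add: hyperbolic_mat_def Let_def cosh_block_def sinh_block_def dim
        append_rows_index append_cols_index diag rect_diag_def\<close>), (arith+)?)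
  next
    case 3
    consider "j < q" | "q \<le> j" "j < p" | "p \<le> j" by linarith
    then show ?thesis
      by cases ((use 3 qp i j in \<open>simp_all add: hyperbolic_mat_def Let_def cosh_block_def sinh_block_def dim
        append_rows_index append_cols_index diag rect_diag_def\<close>), (arith+)?)
  qed
qed

lemma hyperbolic_mat_carrier:
  "q \<le> p \<Longrightarrow> hyperbolic_mat p q \<theta> \<in> carrier_mat (p + q) (p + q)"
  by (simp add: hyperbolic_mat_blocks four_block_carrier_mat)

text \<open>The addition theorems of cosh and sinh, block by block; the factors \<open>i\<close> and
  \<open>-i\<close> of the off-diagonal blocks multiply to 1 and so give the plus sign in
  \<open>cosh_add\<close>. Consequences used later are that negating the angles inverts the factor
  and that squaring doubles them.\<close>

lemma hyperbolic_mat_add: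
  assumes "q \<le> p"
  shows "hyperbolic_mat p q \<theta> * hyperbolic_mat p q \<phi> = hyperbolic_mat p q (\<lambda>i. \<theta> i + \<phi> i)"
proof -
  let ?c = "\<lambda>\<theta> i. complex_of_real (cosh (\<theta> i))" and ?s = "\<lambda>\<theta> i. \<i> * complex_of_real (sinh (\<theta> i))"
  let ?c' = "\<lambda>\<theta> i. if i < q then ?c \<theta> i else 1"
  let ?\<psi> = "\<lambda>i. \<theta> i + \<phi> i"
  have 1: "mat_diag p (?c' \<theta>) * mat_diag p (?c' \<phi>) + rect_diag p q (?s \<theta>) * (rect_diag p q (\<lambda>i. - ?s \<phi> i))\<^sup>T
      = mat_diag p (?c' ?\<psi>)"
    unfolding mult_rect_diag[OF assms] mat_diag_diag
    by (rule eq_matI) (simp_all add: mat_diag_def cosh_add algebra_simps)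
  have 2: "mat_diag p (?c' \<theta>) * rect_diag p q (?s \<phi>) + rect_diag p q (?s \<theta>) * mat_diag q (?c \<phi>)
      = rect_diag p q (?s ?\<psi>)"
    unfolding mult_rect_diag[OF assms]
    by (rule eq_matI) (simp_all add: rect_diag_def sinh_add algebra_simps)
  have 3: "(rect_diag p q (\<lambda>i. - ?s \<theta> i))\<^sup>T * mat_diag p (?c' \<phi>) + mat_diag q (?c \<theta>) * (rect_diag p q (\<lambda>i. - ?s \<phi> i))\<^sup>T
      = (rect_diag p q (\<lambda>i. - ?s ?\<psi> i))\<^sup>T"
  proof -
    \<comment> \<open>The lower left block is computed through its transpose, where the products
      have the shape covered by \<open>mult_rect_diag\<close>.\<close>
    have "(mat_diag p (?c' \<phi>) * rect_diag p q (\<lambda>i. - ?s \<theta> i) + rect_diag p q (\<lambda>i. - ?s \<phi> i) * mat_diag q (?c \<theta>))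
        = rect_diag p q (\<lambda>i. - ?s ?\<psi> i)"
      unfolding mult_rect_diag[OF assms]
      by (rule eq_matI) (simp_all add: rect_diag_def sinh_add algebra_simps)
    from arg_cong[OF this, of transpose_mat] show ?thesis
      by (simp add: transpose_add[of _ p q] transpose_mult[of _ p p _ q] transpose_mult[of _ p q _ q]
          mult_carrier_mat[of _ p p _ q] mult_carrier_mat[of _ p q _ q])
  qed
  have 4: "(rect_diag p q (\<lambda>i. - ?s \<theta> i))\<^sup>T * rect_diag p q (?s \<phi>) + mat_diag q (?c \<theta>) * mat_diag q (?c \<phi>)
      = mat_diag q (?c ?\<psi>)"
    unfolding mult_rect_diag[OF assms] mat_diag_diag
    by (rule eq_matI) (simp_all add: mat_diag_def cosh_add algebra_simps)
  show ?thesis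
    unfolding hyperbolic_mat_blocks[OF assms]
    by (subst mult_four_block_mat[of _ p p _ q _ q _ _ p _ q]) (simp_all add: 1 2 3 4 del: mat_diag_diag)
qed

lemma hyperbolic_mat_zero: "q \<le> p \<Longrightarrow> hyperbolic_mat p q (\<lambda>_. 0) = 1\<^sub>m (p + q)"
  by (rule eq_matI) (auto simp: hyperbolic_mat_blocks mat_diag_def rect_diag_def)

lemma mat_adjoint_hyperbolic_mat: "q \<le> p \<Longrightarrow> mat_adjoint (hyperbolic_mat p q \<theta>) = hyperbolic_mat p q \<theta>"
  by (rule eq_matI) (auto simp: hyperbolic_mat_blocks mat_diag_def rect_diag_def conjugate_complex_def)

text \<open>Conjugation by the form negates exactly the off-diagonal blocks, and these are odd in
  the angles while the diagonal ones are even.\<close>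

lemma hyperbolic_mat_indef_mat:
  assumes "q \<le> p"
  shows "hyperbolic_mat p q \<theta> * indef_mat p q = indef_mat p q * hyperbolic_mat p q (\<lambda>i. - \<theta> i)"
proof -
  note H = hyperbolic_mat_carrier[OF assms]
  show ?thesis
    unfolding indef_mat_eq_mat_diag mat_diag_mult_right[OF H] mat_diag_mult_left[OF H]
    using assms by (intro eq_matI) (auto simp: hyperbolic_mat_blocks mat_diag_def rect_diag_def)
qed

lemma hyperbolic_mat_indef_unitary:
  assumes "q \<le> p"
  shows "hyperbolic_mat p q \<theta> \<in> indef_unitary_group p q"
proof -
  note H = hyperbolic_mat_carrier[OF assms]
  have "mat_adjoint (hyperbolic_mat p q \<theta>) * indef_mat p q * hyperbolic_mat p q \<theta> =
      indef_mat p q * (hyperbolic_mat p q (\<lambda>i. - \<theta> i) * hyperbolic_mat p q \<theta>)"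
    using H by (simp add: mat_adjoint_hyperbolic_mat[OF assms] hyperbolic_mat_indef_mat[OF assms]
        square_mat_simps[where n = "p + q"])
  also have "\<dots> = indef_mat p q"
    by (simp add: hyperbolic_mat_add[OF assms] hyperbolic_mat_zero[OF assms]
      square_mat_simps[where n = "p + q"])
  finally show ?thesis using H by (simp add: indef_unitary_group_def)
qed

section \<open>Normal form of the Gram matrix\<close>

lemma map_mat_Re_mult:
  assumes "X \<in> carrier_mat n m" "Y \<in> carrier_mat m l"
  shows "map_mat Re (X * Y) = map_mat Re X * map_mat Re Y - map_mat Im X * map_mat Im Y"
  using assms by (intro eq_matI) (auto simp: scalar_prod_def sum_subtractf)

lemma map_mat_Im_mult:
  assumes "X \<in> carrier_mat n m" "Y \<in> carrier_mat m l"
  shows "map_mat Im (X * Y) = map_mat Re X * map_mat Im Y + map_mat Im X * map_mat Re Y"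
  using assms by (intro eq_matI) (auto simp: scalar_prod_def sum.distrib)

lemma map_mat_complexify [simp]:
  "map_mat Re (complexify A) = A" "map_mat Im (complexify A) = 0\<^sub>m (dim_row A) (dim_col A)"
  by (auto intro!: eq_matI)

lemma map_mat_Re_Im_indef_mat [simp]:
  "map_mat Re (indef_mat p q) = indef_mat p q" "map_mat Im (indef_mat p q) = 0\<^sub>m (p + q) (p + q)"
  by (auto intro!: eq_matI simp: indef_mat_eq_mat_diag mat_diag_def)

lemma map_mat_Re_Im_congruence:
  assumes "G \<in> carrier_mat n n" "H \<in> carrier_mat n n" "K \<in> carrier_mat n n"
  shows "map_mat Re (complexify G * H * complexify K) = G * map_mat Re H * K"
    "map_mat Im (complexify G * H * complexify K) = G * map_mat Im H * K"
proof -
  have GH: "map_mat Re (complexify G * H) = G * map_mat Re H" "map_mat Im (complexify G * H) = G * map_mat Im H"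
    using assms by (auto simp: map_mat_Re_mult[of _ n n _ n] map_mat_Im_mult[of _ n n _ n] intro!: eq_matI)
  have c: "complexify G * H \<in> carrier_mat n n" using assms by auto
  show "map_mat Re (complexify G * H * complexify K) = G * map_mat Re H * K"
    using assms by (subst map_mat_Re_mult[OF c, of _ n]) (auto simp: GH intro!: eq_matI)
  show "map_mat Im (complexify G * H * complexify K) = G * map_mat Im H * K"
    using assms by (subst map_mat_Im_mult[OF c, of _ n]) (auto simp: GH intro!: eq_matI)
qed

lemma complex_mat_eqI:
  assumes "map_mat Re X = map_mat Re Y" "map_mat Im X = map_mat Im Y"
  shows "X = Y"
proof (rule eq_matI)
  show d: "dim_row X = dim_row Y" "dim_col X = dim_col Y"
    using arg_cong[OF assms(1), of dim_row] arg_cong[OF assms(1), of dim_col] by auto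
  fix i j assume "i < dim_row Y" "j < dim_col Y"
  then show "X $$ (i, j) = Y $$ (i, j)"
    using arg_cong[OF assms(1), of "\<lambda>M. M $$ (i, j)"] arg_cong[OF assms(2), of "\<lambda>M. M $$ (i, j)"] d
    by (simp add: complex_eq_iff)
qed

text \<open>The inner part \<open>U J U^H\<close> of the product collapses to \<open>J\<close>,
  after which the outer \<open>U^H J U\<close> does as well.\<close>

lemma gram_form_preserving:
  assumes "U \<in> indef_unitary_group p q"
  defines "M \<equiv> mat_adjoint U * U" and "J \<equiv> indef_mat p q"
  shows "M * J * M = J"
proof -
  note U = indef_unitary_groupD[OF assms(1), folded J_def]
  have J: "J \<in> carrier_mat (p + q) (p + q)" by (simp add: J_def)
  have "M * J * M = mat_adjoint U * (U * J * mat_adjoint U) * U"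
    using U(1) J by (simp add: M_def square_mat_simps[where n = "p + q"])
  also have "\<dots> = J" unfolding U(3) U(2) ..
  finally show ?thesis .
qed

text \<open>The symmetries of \<open>A\<close> and \<open>B\<close> say that the Gram matrix is
  Hermitian; the two product equations are the real and imaginary parts of
  \<open>gram_form_preserving\<close>, whose form is real.\<close>

lemma gram_real_imag:
  assumes "U \<in> indef_unitary_group p q"
  defines "A \<equiv> map_mat Re (mat_adjoint U * U)" and "B \<equiv> map_mat Im (mat_adjoint U * U)"
    and "J \<equiv> indef_mat p q"
  shows "A \<in> carrier_mat (p + q) (p + q)" "B \<in> carrier_mat (p + q) (p + q)"
    "A\<^sup>T = A" "B\<^sup>T = - B"
    "A * J * A - B * J * B = J" "A * J * B + B * J * A = 0\<^sub>m (p + q) (p + q)"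
    "\<And>x. x \<in> carrier_vec (p + q) \<Longrightarrow> x \<noteq> 0\<^sub>v (p + q) \<Longrightarrow> 0 < x \<bullet> (A *\<^sub>v x)"
proof -
  let ?n = "p + q"
  note U = indef_unitary_groupD[OF assms(1)]
  define M where "M = mat_adjoint U * U"
  have M: "M \<in> carrier_mat ?n ?n" using U by (auto simp: M_def)
  have A_def': "A = map_mat Re M" and B_def': "B = map_mat Im M" by (simp_all add: A_def B_def M_def)
  show A: "A \<in> carrier_mat ?n ?n" and B: "B \<in> carrier_mat ?n ?n" using M by (auto simp: A_def' B_def')
  have J: "J \<in> carrier_mat ?n ?n" by (simp add: J_def)
  have M_index: "M $$ (i, j) = (\<Sum>k<?n. cnj (U $$ (k, i)) * U $$ (k, j))" if "i < ?n" "j < ?n" for i j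
    using that U(1) by (auto simp: M_def scalar_prod_def atLeast0LessThan conjugate_complex_def)
  have cnj_M: "M $$ (i, j) = cnj (M $$ (j, i))" if "i < ?n" "j < ?n" for i j
    using that by (simp add: M_index mult.commute)
  have Re_M: "Re (M $$ (j, i)) = Re (M $$ (i, j))" and Im_M: "Im (M $$ (j, i)) = - Im (M $$ (i, j))"
    if "i < ?n" "j < ?n" for i j
    using arg_cong[OF cnj_M[OF that], of Re] arg_cong[OF cnj_M[OF that], of Im] by simp_all
  show "A\<^sup>T = A" "B\<^sup>T = - B"
    unfolding A_def' B_def' using M by (auto intro!: eq_matI Re_M Im_M)
  have MJ: "map_mat Re (M * indef_mat p q) = A * J" "map_mat Im (M * indef_mat p q) = B * J"
  proof -
    have "A * 0\<^sub>m ?n ?n = 0\<^sub>m ?n ?n" "B * 0\<^sub>m ?n ?n = 0\<^sub>m ?n ?n"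
      using A B by (auto intro: right_mult_zero_mat)
    moreover have "A * J \<in> carrier_mat ?n ?n" "B * J \<in> carrier_mat ?n ?n"
      using A B J by (auto intro: mult_carrier_mat)
    moreover from this A B J have "A * J - 0\<^sub>m ?n ?n = A * J" "0\<^sub>m ?n ?n + B * J = B * J"
      by (auto intro!: eq_matI)
    ultimately show "map_mat Re (M * indef_mat p q) = A * J" "map_mat Im (M * indef_mat p q) = B * J"
      unfolding map_mat_Re_mult[OF M indef_mat_carrier] map_mat_Im_mult[OF M indef_mat_carrier]
        A_def'[symmetric] B_def'[symmetric] map_mat_Re_Im_indef_mat J_def[symmetric]
      by simp_all
  qed
  have MJc: "M * indef_mat p q \<in> carrier_mat ?n ?n" using M by (auto intro: mult_carrier_mat)
  have "map_mat Re (M * indef_mat p q * M) = J" "map_mat Im (M * indef_mat p q * M) = 0\<^sub>m ?n ?n"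
    using gram_form_preserving[OF assms(1)] by (simp_all add: M_def J_def)
  then show "A * J * A - B * J * B = J" and "A * J * B + B * J * A = 0\<^sub>m ?n ?n"
    unfolding map_mat_Re_mult[OF MJc M] map_mat_Im_mult[OF MJc M] MJ A_def'[symmetric] B_def'[symmetric]
    by auto
  fix x :: "real vec" assume x: "x \<in> carrier_vec ?n" "x \<noteq> 0\<^sub>v ?n"
  \<comment> \<open>With \<open>U = X + i Y\<close>, the value \<open>x \<bullet> (A x)\<close> is
    the sum of the squared lengths of \<open>X x\<close> and \<open>Y x\<close>. Both vanish only if
    \<open>U x = 0\<close>, which the invertibility of \<open>U\<close> excludes for nonzero
    \<open>x\<close>.\<close>
  define X where "X = map_mat Re U"
  define Y where "Y = map_mat Im U"
  have X: "X \<in> carrier_mat ?n ?n" and Y: "Y \<in> carrier_mat ?n ?n" using U by (auto simp: X_def Y_def)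
  have "A = X\<^sup>T * X + Y\<^sup>T * Y"
    unfolding A_def' X_def Y_def using M U(1)
    by (intro eq_matI) (auto simp: M_index scalar_prod_def atLeast0LessThan sum.distrib)
  then have "x \<bullet> (A *\<^sub>v x) = x \<bullet> (X\<^sup>T *\<^sub>v (X *\<^sub>v x)) + x \<bullet> (Y\<^sup>T *\<^sub>v (Y *\<^sub>v x))"
    using X Y x(1) by (simp add: add_mult_distrib_mat_vec[of _ ?n ?n] scalar_prod_add_distrib[of _ ?n]
        assoc_mult_mat_vec[of _ ?n ?n _ ?n] mult_carrier_mat[of _ ?n ?n _ ?n]
          mult_mat_vec_carrier[of _ ?n ?n])
  also have "x \<bullet> (X\<^sup>T *\<^sub>v (X *\<^sub>v x)) = (X *\<^sub>v x) \<bullet> (X *\<^sub>v x)"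
    using transpose_vec_mult_scalar[OF X x(1), of "X *\<^sub>v x"] X x(1)
    by (subst comm_scalar_prod[of _ ?n]) (auto intro!: mult_mat_vec_carrier[of _ ?n ?n])
  also have "x \<bullet> (Y\<^sup>T *\<^sub>v (Y *\<^sub>v x)) = (Y *\<^sub>v x) \<bullet> (Y *\<^sub>v x)"
    using transpose_vec_mult_scalar[OF Y x(1), of "Y *\<^sub>v x"] Y x(1)
    by (subst comm_scalar_prod[of _ ?n]) (auto intro!: mult_mat_vec_carrier[of _ ?n ?n])
  finally have eq: "x \<bullet> (A *\<^sub>v x) = (X *\<^sub>v x) \<bullet> (X *\<^sub>v x) + (Y *\<^sub>v x) \<bullet> (Y *\<^sub>v x)" .
  have cX: "X *\<^sub>v x \<in> carrier_vec ?n" and cY: "Y *\<^sub>v x \<in> carrier_vec ?n"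
    using X Y x by (auto intro!: mult_mat_vec_carrier[of _ ?n ?n])
  have "X *\<^sub>v x \<noteq> 0\<^sub>v ?n \<or> Y *\<^sub>v x \<noteq> 0\<^sub>v ?n"
  proof (rule ccontr)
    let ?x = "map_vec complex_of_real x"
    assume "\<not> ?thesis"
    then have X0: "X *\<^sub>v x = 0\<^sub>v ?n" and Y0: "Y *\<^sub>v x = 0\<^sub>v ?n" by auto
    have "U *\<^sub>v ?x = 0\<^sub>v ?n"
    proof (rule eq_vecI)
      fix i assume "i < dim_vec (0\<^sub>v ?n :: complex vec)"
      then have i: "i < ?n" by simp
      show "(U *\<^sub>v ?x) $ i = 0\<^sub>v ?n $ i"
        using arg_cong[OF X0, of "\<lambda>v. v $ i"] arg_cong[OF Y0, of "\<lambda>v. v $ i"] i U(1) x(1)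
        by (simp add: X_def Y_def scalar_prod_def complex_eq_iff)
    qed (use U in auto)
    then have "((indef_mat p q * mat_adjoint U * indef_mat p q) * U) *\<^sub>v ?x = 0\<^sub>v ?n"
      using U(1) x(1)
      by (subst assoc_mult_mat_vec[of _ ?n ?n _ ?n])
        (auto intro!: mult_carrier_mat[of _ ?n ?n _ ?n] mult_mat_zero_vec[of _ ?n ?n])
    then have "?x = 0\<^sub>v ?n" using x(1) by (simp add: U(4))
    then have "x = 0\<^sub>v ?n" using of_real_hom.vec_hom_zero_iff by blast
    with x show False by simp
  qed
  then show "0 < x \<bullet> (A *\<^sub>v x)"
    unfolding eq using real_scalar_prod_self[OF cX] real_scalar_prod_self[OF cY] by linarith
qed

text \<open>Uniqueness of the positive square root, seen entrywise:
  \<open>d_i^2 P_ij = P_ij c_j^2\<close>, so wherever \<open>P_ij\<close> is nonzero, positivity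
  gives \<open>d_i = c_j\<close>. Thus \<open>P\<close> intertwines the roots as it does the
  squares.\<close>

lemma diag_sqrt_unique:
  assumes Po: "P \<in> orthogonal_group n"
    and d: "\<And>i. i < n \<Longrightarrow> 0 < d i" and c: "\<And>i. i < n \<Longrightarrow> 0 < c i"
    and eq: "mat_diag n (\<lambda>i. d i * d i) = P * mat_diag n (\<lambda>i. c i * c i) * P\<^sup>T"
  shows "mat_diag n d = P * mat_diag n c * P\<^sup>T"
proof -
  note P = orthogonal_groupD[OF Po]
  have "mat_diag n (\<lambda>i. d i * d i) * P = P * mat_diag n (\<lambda>i. c i * c i)"
    unfolding eq using P by (simp add: square_mat_simps[where n = n])
  then have dc2: "d i * d i * P $$ (i, j) = P $$ (i, j) * (c j * c j)" if "i < n" "j < n" for i j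
    unfolding mat_diag_mult_left[OF P(1)] mat_diag_mult_right[OF P(1)]
    using that by (auto dest!: arg_cong[of _ _ "\<lambda>M. M $$ (i, j)"])
  have dc: "d i * P $$ (i, j) = P $$ (i, j) * c j" if ij: "i < n" "j < n" for i j
  proof (cases "P $$ (i, j) = 0")
    case False
    then have "d i * d i = c j * c j" using dc2[OF ij] by simp
    then have "d i = c j" using d[OF ij(1)] c[OF ij(2)] square_eq_iff[of "d i" "c j"] by auto
    then show ?thesis by simp
  qed simp
  have "mat_diag n d * P = P * mat_diag n c"
    unfolding mat_diag_mult_left[OF P(1)] mat_diag_mult_right[OF P(1)]
    by (rule eq_matI) (auto simp: dc)
  then have "mat_diag n d * (P * P\<^sup>T) = P * mat_diag n c * P\<^sup>T"
    using P(1) by (simp add: square_mat_simps[where n = n] assoc_mult_mat[symmetric, of _ n n P n _ n])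
  then show ?thesis using P(3) by (simp add: square_mat_simps[where n = n])
qed

lemma block_diag_sandwich:
  fixes A :: "'a :: comm_ring_1 mat"
  assumes "P \<in> carrier_mat p p" "Q \<in> carrier_mat q q"
    "A \<in> carrier_mat p p" "B \<in> carrier_mat p q" "C \<in> carrier_mat q p" "D \<in> carrier_mat q q"
  defines "K \<equiv> four_block_mat P (0\<^sub>m p q) (0\<^sub>m q p) Q"
  shows "K * four_block_mat A B C D * K\<^sup>T =
    four_block_mat (P * A * P\<^sup>T) (P * B * Q\<^sup>T) (Q * C * P\<^sup>T) (Q * D * Q\<^sup>T)"
proof -
  have "K * four_block_mat A B C D = four_block_mat (P * A) (P * B) (Q * C) (Q * D)"
    unfolding K_def using assms(1-6)
    by (subst mult_four_block_mat[of _ p p _ q _ q _ _ p _ q])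
      (auto intro!: cong_four_block_mat simp: mult_carrier_mat[of _ p p _ p]
        mult_carrier_mat[of _ p p _ q] mult_carrier_mat[of _ q q _ p] mult_carrier_mat[of _ q q _ q])
  moreover have "K\<^sup>T = four_block_mat P\<^sup>T (0\<^sub>m p q) (0\<^sub>m q p) Q\<^sup>T"
    unfolding K_def using assms(1-6) by (subst transpose_four_block_mat[of _ p p _ q _ q]) auto
  moreover have "four_block_mat (P * A) (P * B) (Q * C) (Q * D) * four_block_mat P\<^sup>T (0\<^sub>m p q) (0\<^sub>m q p) Q\<^sup>T =
      four_block_mat (P * A * P\<^sup>T) (P * B * Q\<^sup>T) (Q * C * P\<^sup>T) (Q * D * Q\<^sup>T)"
    using assms(1-6)
    by (subst mult_four_block_mat[of _ p p _ q _ q _ _ p _ q])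
      (auto intro!: cong_four_block_mat simp: mult_carrier_mat[of _ p p _ p]
        mult_carrier_mat[of _ p p _ q] mult_carrier_mat[of _ q q _ p] mult_carrier_mat[of _ q q _ q]
        mult_carrier_mat[of _ p q _ q] mult_carrier_mat[of _ q p _ p] right_mult_zero_mat[of _ p q]
          right_mult_zero_mat[of _ p p] right_mult_zero_mat[of _ q q] right_mult_zero_mat[of _ q p])
  ultimately show ?thesis by simp
qed

lemma sum_lessThan_add:
  "(\<Sum>k<p + q. f k) = (\<Sum>k<p. f k) + (\<Sum>k<q. f (p + k))" for p q :: nat and f :: "nat \<Rightarrow> 'a :: comm_monoid_add"
  by (induction q) (auto simp: add.assoc)

lemma mat_diag_four_block:
  "mat_diag (p + q) f = four_block_mat (mat_diag p f) (0\<^sub>m p q) (0\<^sub>m q p) (mat_diag q (\<lambda>i. f (p + i)))"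
  by (rule eq_matI) (auto simp: mat_diag_def)

lemma one_plus_congruence_diag:
  assumes "P \<in> orthogonal_group n"
  shows "1\<^sub>m n + P * mat_diag n f * P\<^sup>T = P * mat_diag n (\<lambda>i. 1 + f i) * P\<^sup>T"
proof -
  note P = orthogonal_groupD[OF assms]
  have "mat_diag n (\<lambda>i. 1 + f i) = 1\<^sub>m n + mat_diag n f"
    by (rule eq_matI) (auto simp: mat_diag_def)
  then show ?thesis
    using P by (simp add: mult_add_distrib_mat[of _ n n _ n] add_mult_distrib_mat[of _ n n _ _ n]
        mult_carrier_mat[of _ n n _ n])
qed

text \<open>The transpose is what enters the matrix \<open>G\<close> of the normal form; its
  defining equation is \<open>K J K^T = J\<close>, an instance of the block sandwich.\<close>

lemma block_diag_indef_orthogonal: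
  assumes "P \<in> orthogonal_group p" "Q \<in> orthogonal_group q"
  shows "(four_block_mat P (0\<^sub>m p q) (0\<^sub>m q p) Q)\<^sup>T \<in> indef_orthogonal_group p q"
proof -
  note P = orthogonal_groupD[OF assms(1)] and Q = orthogonal_groupD[OF assms(2)]
  let ?K = "four_block_mat P (0\<^sub>m p q) (0\<^sub>m q p) Q"
  have "?K * indef_mat p q * ?K\<^sup>T =
      four_block_mat (P * 1\<^sub>m p * P\<^sup>T) (P * 0\<^sub>m p q * Q\<^sup>T) (Q * 0\<^sub>m q p * P\<^sup>T) (Q * (- 1\<^sub>m q) * Q\<^sup>T)"
    unfolding indef_mat_def by (rule block_diag_sandwich) (use P Q in auto)
  also have "\<dots> = indef_mat p q"
  proof -
    have "Q * (- 1\<^sub>m q) * Q\<^sup>T = - 1\<^sub>m q" using Q by simp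
    then show ?thesis using P Q
      by (simp add: indef_mat_def right_mult_zero_mat[of _ p p] right_mult_zero_mat[of _ q q]
          left_mult_zero_mat[of _ p p] left_mult_zero_mat[of _ q q])
  qed
  finally show ?thesis using P(1) Q(1) by (simp add: indef_orthogonal_group_def four_block_carrier_mat)
qed

text \<open>The first \<open>p\<close> columns of \<open>B\<close> live on the coordinates where the
  form is -1, the last \<open>q\<close> on those where it is 1; hence the opposite signs.\<close>

lemma off_diagonal_congruence_sum:
  fixes X :: "real mat" and p q :: nat
  defines "B \<equiv> four_block_mat (0\<^sub>m p p) X (- X\<^sup>T) (0\<^sub>m q q)"
  assumes X: "X \<in> carrier_mat p q"
  shows "\<And>i j. i < p \<Longrightarrow> j < p \<Longrightarrow> (B\<^sup>T * indef_mat p q * B) $$ (i, j) = - (X * X\<^sup>T) $$ (i, j)"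
    and "\<And>i j. i < q \<Longrightarrow> j < q \<Longrightarrow> (B\<^sup>T * indef_mat p q * B) $$ (p + i, p + j) = (X\<^sup>T * X) $$ (i, j)"
proof -
  have B: "B \<in> carrier_mat (p + q) (p + q)" using X by (simp add: B_def four_block_carrier_mat)
  show "(B\<^sup>T * indef_mat p q * B) $$ (i, j) = - (X * X\<^sup>T) $$ (i, j)" if "i < p" "j < p" for i j
    using that X unfolding indef_mat_eq_mat_diag
    by (subst index_congruence_diag[OF B]) (auto simp: B_def sum_lessThan_add scalar_prod_def atLeast0LessThan sum_negf)
  show "(B\<^sup>T * indef_mat p q * B) $$ (p + i, p + j) = (X\<^sup>T * X) $$ (i, j)" if "i < q" "j < q" for i j
    using that X unfolding indef_mat_eq_mat_diag
    by (subst index_congruence_diag[OF B]) (auto simp: B_def sum_lessThan_add scalar_prod_def atLeast0LessThan)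
qed

text \<open>The inner matrices are the real and imaginary parts of the hyperbolic factor with angles
  \<open>arsinh (s i)\<close>, because \<open>cosh (arsinh s) = sqrt (1 + s^2)\<close>.\<close>

theorem gram_normal_form:
  fixes A B :: "real mat" and p q :: nat
  defines "J \<equiv> indef_mat p q"
  assumes qp: "q \<le> p"
    and A: "A \<in> carrier_mat (p + q) (p + q)" and B: "B \<in> carrier_mat (p + q) (p + q)"
    and symA: "A\<^sup>T = A" and symB: "B\<^sup>T = - B"
    and ABre: "A * J * A - B * J * B = J" and ABim: "A * J * B + B * J * A = 0\<^sub>m (p + q) (p + q)"
    and pos: "\<And>x. x \<in> carrier_vec (p + q) \<Longrightarrow> x \<noteq> 0\<^sub>v (p + q) \<Longrightarrow> 0 < x \<bullet> (A *\<^sub>v x)"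
  obtains G s where "G \<in> indef_orthogonal_group p q"
    "A = G\<^sup>T * four_block_mat (mat_diag p (\<lambda>i. if i < q then sqrt (1 + s i * s i) else 1)) (0\<^sub>m p q) (0\<^sub>m q p)
      (mat_diag q (\<lambda>i. sqrt (1 + s i * s i))) * G"
    "B = G\<^sup>T * four_block_mat (0\<^sub>m p p) (rect_diag p q s) (- (rect_diag p q s)\<^sup>T) (0\<^sub>m q q) * G"
proof -
  let ?n = "p + q"
  let ?\<epsilon> = "\<lambda>i. if i < p then 1 else - 1 :: real"
  note sq = square_mat_simps[where n = "p + q"]
  have J: "J \<in> carrier_mat ?n ?n" and J_diag: "J = mat_diag ?n ?\<epsilon>"
    by (simp_all add: J_def indef_mat_eq_mat_diag)
  have eps: "\<bar>?\<epsilon> k\<bar> = 1" for k by simp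
  obtain T d where T: "T \<in> carrier_mat ?n ?n"
    and TJ': "T\<^sup>T * mat_diag ?n ?\<epsilon> * T = mat_diag ?n ?\<epsilon>"
    and AT: "A = T\<^sup>T * mat_diag ?n d * T" and d: "\<And>k. k < ?n \<Longrightarrow> 0 < d k"
    by (rule simultaneous_congruence[where a = ?\<epsilon>, OF A symA pos eps]; (rule that)?; assumption)
  have TJ: "T\<^sup>T * J * T = J" unfolding J_diag by (rule TJ')
  have To: "T \<in> indef_orthogonal_group p q" using T TJ by (simp add: indef_orthogonal_group_def J_def)
  note T' = indef_orthogonal_groupD[OF To, folded J_def]
  \<comment> \<open>\<open>S\<close> is the inverse of \<open>T\<close>, because \<open>T\<close>
    preserves \<open>J\<close>. The matrix \<open>C\<close> below is \<open>B\<close> in the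
    coordinates in which \<open>A\<close> is diagonal.\<close>
  define S where "S = J * T\<^sup>T * J"
  have S: "S \<in> carrier_mat ?n ?n" using T J by (auto simp: S_def intro!: mult_carrier_mat)
  have ST: "S * T = 1\<^sub>m ?n" "T * S = 1\<^sub>m ?n" using T' by (simp_all add: S_def)
  have TS: "T\<^sup>T * S\<^sup>T = 1\<^sub>m ?n" "S\<^sup>T * T\<^sup>T = 1\<^sub>m ?n"
    by (simp_all add: transpose_mult[OF S T, symmetric] transpose_mult[OF T S, symmetric] ST)
  have SJS: "S\<^sup>T * J * S = J"
  proof -
    have "S\<^sup>T * J * S = S\<^sup>T * (T\<^sup>T * J * T) * S" by (simp add: TJ)
    also have "\<dots> = (S\<^sup>T * T\<^sup>T) * J * (T * S)" using S T J by (simp add: sq)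
    finally show ?thesis using J by (simp add: ST TS)
  qed
  let ?D = "mat_diag ?n d"
  define C where "C = S\<^sup>T * B * S"
  have C: "C \<in> carrier_mat ?n ?n" using S B by (auto simp: C_def intro!: mult_carrier_mat)
  have BC: "B = T\<^sup>T * C * T"
  proof -
    have "T\<^sup>T * C * T = (T\<^sup>T * S\<^sup>T) * B * (S * T)" using S T B by (simp add: C_def sq)
    then show ?thesis using B by (simp add: ST TS)
  qed
  have symC: "C\<^sup>T = - C"
  proof -
    have "C\<^sup>T = S\<^sup>T * (- B) * S" using S B by (simp add: C_def sq symB)
    then show ?thesis using S B by (simp add: C_def sq uminus_mult_left_mat uminus_mult_right_mat)
  qed
  \<comment> \<open>The inner \<open>J\<close> survives because \<open>T * J * T^T = J\<close>; so
    the equations for \<open>A\<close> and \<open>B\<close> carry over verbatim to \<open>?D\<close>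
    and \<open>C\<close>.\<close>
  have conj: "S\<^sup>T * ((T\<^sup>T * X * T) * J * (T\<^sup>T * Y * T)) * S = X * J * Y"
    if "X \<in> carrier_mat ?n ?n" "Y \<in> carrier_mat ?n ?n" for X Y
  proof -
    have "S\<^sup>T * ((T\<^sup>T * X * T) * J * (T\<^sup>T * Y * T)) * S = (S\<^sup>T * T\<^sup>T) * X * (T * J * T\<^sup>T) * Y * (T * S)"
      using that S T J by (simp add: sq)
    then show ?thesis using that J by (simp add: ST TS T' mult_carrier_mat[of _ ?n ?n _ ?n])
  qed
  have AA: "S\<^sup>T * (A * J * A) * S = ?D * J * ?D" "S\<^sup>T * (B * J * B) * S = C * J * C"
      "S\<^sup>T * (A * J * B) * S = ?D * J * C" "S\<^sup>T * (B * J * A) * S = C * J * ?D"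
    unfolding AT BC by (intro conj C mat_diag_dim)+
  have cAA: "A * J * A \<in> carrier_mat ?n ?n" "B * J * B \<in> carrier_mat ?n ?n"
      "A * J * B \<in> carrier_mat ?n ?n" "B * J * A \<in> carrier_mat ?n ?n"
    using A B J by (auto intro!: mult_carrier_mat[of _ ?n ?n _ ?n])
  have "S\<^sup>T * (A * J * A - B * J * B) * S = S\<^sup>T * (A * J * A) * S - S\<^sup>T * (B * J * B) * S"
    using cAA S by (simp add: mult_minus_distrib_mat[of _ ?n ?n] minus_mult_distrib_mat[of _ ?n ?n]
      mult_carrier_mat[of _ ?n ?n _ ?n])
  then have re: "?D * J * ?D - C * J * C = J"
    unfolding ABre SJS AA ..
  have "S\<^sup>T * (A * J * B + B * J * A) * S = S\<^sup>T * (A * J * B) * S + S\<^sup>T * (B * J * A) * S"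
    using cAA S by (simp add: mult_add_distrib_mat[of _ ?n ?n] add_mult_distrib_mat[of _ ?n ?n]
      mult_carrier_mat[of _ ?n ?n _ ?n])
  then have im: "?D * J * C + C * J * ?D = 0\<^sub>m ?n ?n"
    unfolding ABim AA using S by (simp add: right_mult_zero_mat[of _ ?n ?n] left_mult_zero_mat[of _ ?n ?n])
  have C_index: "(d i * ?\<epsilon> i + ?\<epsilon> j * d j) * C $$ (i, j) = 0" if ij: "i < ?n" "j < ?n" for i j
  proof -
    have 1: "(?D * J * C) $$ (i, j) = d i * ?\<epsilon> i * C $$ (i, j)"
      unfolding J_diag mat_diag_diag mat_diag_mult_left[OF C] using ij by simp
    have "C * J * ?D = C * (J * ?D)" using C J by (simp add: sq)
    then have 2: "(C * J * ?D) $$ (i, j) = C $$ (i, j) * (?\<epsilon> j * d j)"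
      unfolding J_diag mat_diag_diag mat_diag_mult_right[OF C] using ij by simp
    have "C * J * ?D \<in> carrier_mat ?n ?n" using C J by (simp add: sq)
    then have "(?D * J * C + C * J * ?D) $$ (i, j) = (?D * J * C) $$ (i, j) + (C * J * ?D) $$ (i, j)"
      using ij by (intro index_add_mat(1)) auto
    then show ?thesis unfolding im 1 2 using ij by (simp add: algebra_simps)
  qed
  \<comment> \<open>For two indices in the same block the bracket in \<open>C_index\<close> is
    \<open>d i + d j\<close> up to sign, which is nonzero.\<close>
  have C0: "C $$ (i, j) = 0" if "i < p \<and> j < p \<or> p \<le> i \<and> p \<le> j" "i < ?n" "j < ?n" for i j
    using C_index[of i j] d[of i] d[of j] that by auto
  have C_skew: "C $$ (j, i) = - C $$ (i, j)" if "i < ?n" "j < ?n" for i j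
    using arg_cong[OF symC, of "\<lambda>M. M $$ (i, j)"] that C by auto
  define X where "X = mat p q (\<lambda>(i,j). C $$ (i, p + j))"
  have X: "X \<in> carrier_mat p q" by (simp add: X_def)
  have C_block: "C = four_block_mat (0\<^sub>m p p) X (- X\<^sup>T) (0\<^sub>m q q)"
  proof (rule eq_matI)
    fix i j assume "i < dim_row (four_block_mat (0\<^sub>m p p) X (- X\<^sup>T) (0\<^sub>m q q))"
      "j < dim_col (four_block_mat (0\<^sub>m p p) X (- X\<^sup>T) (0\<^sub>m q q))"
    then have ij: "i < ?n" "j < ?n" using X by auto
    show "C $$ (i, j) = four_block_mat (0\<^sub>m p p) X (- X\<^sup>T) (0\<^sub>m q q) $$ (i, j)"
      using ij C0[of i j] C_skew[of j i] by (auto simp: X_def)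
  qed (use C X in auto)
  \<comment> \<open>Skew symmetry replaces \<open>- C J C\<close> by the congruence
    \<open>C^T J C\<close>, whose diagonal blocks are known from
    \<open>off_diagonal_congruence_sum\<close>.\<close>
  have CJC: "?D * J * ?D + C\<^sup>T * J * C = J"
    using re C J by (simp add: symC minus_add_uminus_mat[of _ ?n ?n]
      uminus_mult_left_mat mult_carrier_mat[of _ ?n ?n _ ?n])
  have CJC_index: "(if i = j then d i * ?\<epsilon> i * d i else 0) + (C\<^sup>T * J * C) $$ (i, j) = (if i = j then ?\<epsilon> i else 0)"
    if ij: "i < ?n" "j < ?n" for i j
  proof -
    have "C\<^sup>T * J * C \<in> carrier_mat ?n ?n" using C J by (simp add: sq)
    then have "(?D * J * ?D + C\<^sup>T * J * C) $$ (i, j) = (?D * J * ?D) $$ (i, j) + (C\<^sup>T * J * C) $$ (i, j)"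
      using ij by (intro index_add_mat(1)) auto
    then show ?thesis
      unfolding CJC using ij by (simp add: J_diag) (auto simp: mat_diag_def split: if_splits)
  qed
  have CC: "(C\<^sup>T * J * C) $$ (i, j) = - (X * X\<^sup>T) $$ (i, j)" if "i < p" "j < p" for i j
    using off_diagonal_congruence_sum(1)[OF X that] by (simp add: C_block J_def)
  have CC': "(C\<^sup>T * J * C) $$ (p + i, p + j) = (X\<^sup>T * X) $$ (i, j)" if "i < q" "j < q" for i j
    using off_diagonal_congruence_sum(2)[OF X that] by (simp add: C_block J_def)
  \<comment> \<open>With the signs of \<open>J\<close>, the upper block of \<open>CJC\<close> reads
    \<open>d^2 - X X^T = 1\<close> and the lower one \<open>- d^2 + X^T X = -1\<close>.\<close>
  have D1: "mat_diag p (\<lambda>i. d i * d i) = 1\<^sub>m p + X * X\<^sup>T"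
  proof (rule eq_matI)
    fix i j assume "i < dim_row (1\<^sub>m p + X * X\<^sup>T)" "j < dim_col (1\<^sub>m p + X * X\<^sup>T)"
    then have "i < p" "j < p" using X by auto
    then show "mat_diag p (\<lambda>i. d i * d i) $$ (i, j) = (1\<^sub>m p + X * X\<^sup>T) $$ (i, j)"
      using CJC_index[of i j] CC[of i j]
        X by (auto simp: mat_diag_def simp del: index_mult_mat(1) split: if_splits)
  qed (use X in \<open>auto simp: mat_diag_def\<close>)
  have D2: "mat_diag q (\<lambda>i. d (p + i) * d (p + i)) = 1\<^sub>m q + X\<^sup>T * X"
  proof (rule eq_matI)
    fix i j assume "i < dim_row (1\<^sub>m q + X\<^sup>T * X)" "j < dim_col (1\<^sub>m q + X\<^sup>T * X)"
    then have "i < q" "j < q" using X by auto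
    then show "mat_diag q (\<lambda>i. d (p + i) * d (p + i)) $$ (i, j) = (1\<^sub>m q + X\<^sup>T * X) $$ (i, j)"
      using CJC_index[of "p + i" "p + j"] CC'[of i j]
        X by (auto simp: mat_diag_def simp del: index_mult_mat(1) split: if_splits)
  qed (use X in \<open>auto simp: mat_diag_def\<close>)
  obtain P Q s where Po: "P \<in> orthogonal_group p" and Qo: "Q \<in> orthogonal_group q"
    and XP: "X = P * rect_diag p q s * Q\<^sup>T"
    using real_svd[OF X qp] by blast
  note P = orthogonal_groupD[OF Po] and Q = orthogonal_groupD[OF Qo]
  let ?R = "rect_diag p q s"
  \<comment> \<open>One function serves both blocks. The value 1 for \<open>i\<close> from
    \<open>q\<close> on comes from the zero rows of \<open>?R\<close>.\<close>
  define c where "c i = (if i < q then sqrt (1 + s i * s i) else 1)" for i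
  have c0: "0 < c i" for i unfolding c_def by (simp add: add_pos_nonneg)
  have cc: "c i * c i = 1 + (if i < q then s i * s i else 0)" for i unfolding c_def by simp
  have R: "?R \<in> carrier_mat p q" by simp
  have "X * X\<^sup>T = P * (?R * (Q\<^sup>T * Q) * ?R\<^sup>T) * P\<^sup>T"
    unfolding XP using P(1) Q(1) R
    by (simp add: transpose_mult[of _ p q _ q] transpose_mult[of _ p p _ q]
      mult_carrier_mat[of _ p p _ q] mult_carrier_mat[of _ p q _ q]
        mult_carrier_mat[of _ q p _ p] mult_carrier_mat[of _ q q _ q] mult_carrier_mat[of _ q q _ p]
          mult_carrier_mat[of _ p q _ p]
        assoc_mult_mat[of _ p p _ q _ q] assoc_mult_mat[of _ p p _ q _ p]
          assoc_mult_mat[of _ p q _ q _ p] assoc_mult_mat[of _ q q _ q _ p]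
            assoc_mult_mat[of _ p q _ p _ p] assoc_mult_mat[of _ q q _ p _ p]
              assoc_mult_mat[of _ p p _ p _ p])
  then have "1\<^sub>m p + X * X\<^sup>T = P * mat_diag p (\<lambda>i. c i * c i) * P\<^sup>T"
    using one_plus_congruence_diag[OF Po, of "\<lambda>i. if i < q then s i * s i else 0"]
    by (simp add: Q mult_rect_diag[OF qp] right_mult_one_mat[OF R] cc)
  \<comment> \<open>The factor \<open>P\<close> of the singular value decomposition diagonalizes
    \<open>d^2\<close> by \<open>D1\<close>, hence also its positive root \<open>d\<close>; likewise
    \<open>Q\<close> for the lower block.\<close>
  then have DP: "mat_diag p d = P * mat_diag p c * P\<^sup>T"
    using D1 d c0 by - (rule diag_sqrt_unique[OF Po], auto)
  have "X\<^sup>T * X = Q * (?R\<^sup>T * (P\<^sup>T * P) * ?R) * Q\<^sup>T"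
    unfolding XP using P(1) Q(1) R
    by (simp add: transpose_mult[of _ p q _ q] transpose_mult[of _ p p _ q]
      mult_carrier_mat[of _ p p _ q] mult_carrier_mat[of _ p q _ q]
        mult_carrier_mat[of _ q p _ p] mult_carrier_mat[of _ q p _ q] mult_carrier_mat[of _ q q _ q]
          mult_carrier_mat[of _ q q _ p] mult_carrier_mat[of _ p p _ p]
        assoc_mult_mat[of _ q q _ p _ p] assoc_mult_mat[of _ q q _ p _ q]
          assoc_mult_mat[of _ q p _ p _ q] assoc_mult_mat[of _ q p _ p _ p]
        assoc_mult_mat[of _ p p _ q _ q] assoc_mult_mat[of _ p p _ p _ q]
          assoc_mult_mat[of _ q q _ q _ q] assoc_mult_mat[of _ q p _ q _ q])
  then have "1\<^sub>m q + X\<^sup>T * X = Q * mat_diag q (\<lambda>i. 1 + s i * s i) * Q\<^sup>T"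
    using one_plus_congruence_diag[OF Qo, of "\<lambda>i. s i * s i"] R
    by (simp add: P mult_rect_diag[OF qp])
  also have "mat_diag q (\<lambda>i. 1 + s i * s i) = mat_diag q (\<lambda>i. c i * c i)"
    by (rule eq_matI) (auto simp: mat_diag_def cc)
  finally have DQ: "mat_diag q (\<lambda>i. d (p + i)) = Q * mat_diag q c * Q\<^sup>T"
    using D2 d c0 by - (rule diag_sqrt_unique[OF Qo], auto)
  define K where "K = four_block_mat P (0\<^sub>m p q) (0\<^sub>m q p) Q"
  have Ko: "K\<^sup>T \<in> indef_orthogonal_group p q"
    unfolding K_def by (rule block_diag_indef_orthogonal[OF Po Qo])
  have K: "K \<in> carrier_mat ?n ?n" using P Q by (simp add: K_def four_block_carrier_mat)
  let ?C = "four_block_mat (mat_diag p c) (0\<^sub>m p q) (0\<^sub>m q p) (mat_diag q c)"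
  let ?E = "four_block_mat (0\<^sub>m p p) ?R (- ?R\<^sup>T) (0\<^sub>m q q)"
  have CE: "?C \<in> carrier_mat ?n ?n" "?E \<in> carrier_mat ?n ?n" by (simp_all add: four_block_carrier_mat)
  have DK: "?D = K * ?C * K\<^sup>T"
    unfolding K_def mat_diag_four_block DP DQ using P(1) Q(1)
    by (subst block_diag_sandwich) (auto intro!: cong_four_block_mat simp: right_mult_zero_mat[of _ p p]
      right_mult_zero_mat[of _ q q]
        left_mult_zero_mat[of _ q q] left_mult_zero_mat[of _ p p])
  have "(P * ?R * Q\<^sup>T)\<^sup>T = Q * ?R\<^sup>T * P\<^sup>T"
    using P(1) Q(1) R by (simp add: transpose_mult[of _ p q _ q] transpose_mult[of _ p p _ q]
      mult_carrier_mat[of _ p p _ q] assoc_mult_mat[of _ q q _ p _ p])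
  moreover have "- (Q * ?R\<^sup>T * P\<^sup>T) = Q * (- ?R\<^sup>T) * P\<^sup>T"
    using P(1) Q(1) carrier_matD[OF R] by simp
  ultimately have nX: "- X\<^sup>T = Q * (- ?R\<^sup>T) * P\<^sup>T" unfolding XP by simp
  have CK: "C = K * ?E * K\<^sup>T"
  proof -
    have "K * ?E * K\<^sup>T = four_block_mat (P * 0\<^sub>m p p * P\<^sup>T) X (- X\<^sup>T) (Q * 0\<^sub>m q q * Q\<^sup>T)"
      unfolding K_def nX unfolding XP by (rule block_diag_sandwich) (use P(1) Q(1) in auto)
    also have "\<dots> = C"
      unfolding C_block using P(1) Q(1)
      by (simp add: right_mult_zero_mat[of _ p p] right_mult_zero_mat[of _ q q]
        left_mult_zero_mat[of _ p p] left_mult_zero_mat[of _ q q])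
    finally show ?thesis ..
  qed
  define G where "G = K\<^sup>T * T"
  have G: "G \<in> indef_orthogonal_group p q" unfolding G_def by (rule indef_orthogonal_group_mult[OF Ko To])
  have "A = G\<^sup>T * ?C * G" unfolding AT DK G_def using K T CE by (simp add: sq)
  moreover have "B = G\<^sup>T * ?E * G" unfolding BC CK G_def using K T CE by (simp add: sq)
  moreover have "mat_diag p c = mat_diag p (\<lambda>i. if i < q then sqrt (1 + s i * s i) else 1)"
    by (simp add: c_def[abs_def])
  moreover have "mat_diag q c = mat_diag q (\<lambda>i. sqrt (1 + s i * s i))"
    by (rule eq_matI) (auto simp: mat_diag_def c_def)
  ultimately show thesis using G by (intro that[of G s]) simp_all
qed

section \<open>The factorization\<close>

lemma complexify_mult:
  assumes "A \<in> carrier_mat n m" "B \<in> carrier_mat m l"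
  shows "complexify (A * B) = complexify A * complexify B"
  by (rule of_real_hom.mat_hom_mult[OF assms])

lemma complexify_indef_orthogonal:
  assumes "G \<in> indef_orthogonal_group p q"
  shows "complexify G \<in> indef_unitary_group p q"
proof -
  note G = indef_orthogonal_groupD[OF assms]
  have "mat_adjoint (complexify G) * indef_mat p q * complexify G = complexify (G\<^sup>T * indef_mat p q * G)"
    using G(1) by (simp add: mat_adjoint_complexify complexify_mult[of _ "p + q" "p + q" _ "p + q"]
        mult_carrier_mat[of _ "p + q" "p + q" _ "p + q"])
  then show ?thesis using G(1) by (simp add: indef_unitary_group_def G(2))
qed

lemma indef_unitary_group_mult:
  assumes "G \<in> indef_unitary_group p q" "H \<in> indef_unitary_group p q"
  shows "G * H \<in> indef_unitary_group p q"
proof -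
  note G = indef_unitary_groupD[OF assms(1)] and H = indef_unitary_groupD[OF assms(2)]
  let ?J = "indef_mat p q :: complex mat"
  have "mat_adjoint (G * H) * ?J * (G * H) = mat_adjoint H * (mat_adjoint G * ?J * G) * H"
    using G(1) H(1) by (simp add: mat_adjoint_mult[of _ "p + q" "p + q" _ "p + q"]
      square_mat_simps[where n = "p + q"])
  also have "\<dots> = ?J" unfolding G(2) using H(2) .
  finally show ?thesis using G(1) H(1) by (auto simp: indef_unitary_group_def)
qed

text \<open>The matrix is the inverse of \<open>G\<close>; that it preserves the form reduces to
  \<open>G J G^H = J\<close>.\<close>

lemma indef_unitary_group_inverse:
  assumes "G \<in> indef_unitary_group p q"
  shows "indef_mat p q * mat_adjoint G * indef_mat p q \<in> indef_unitary_group p q"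
proof -
  note G = indef_unitary_groupD[OF assms]
  let ?J = "indef_mat p q :: complex mat" and ?n = "p + q"
  have aa: "mat_adjoint (mat_adjoint G) = G" using G(1) by (intro eq_matI) auto
  have JJ: "?J * (?J * X) = X" if "X \<in> carrier_mat ?n ?n" for X
    using that by (simp add: inverse_pair_cancel[of _ ?n _ _ ?n])
  have "mat_adjoint (?J * mat_adjoint G * ?J) * ?J * (?J * mat_adjoint G * ?J) = ?J * (G * ?J * mat_adjoint G) * ?J"
    using G(1) by (simp add: mat_adjoint_mult[of _ ?n ?n _ ?n] aa JJ square_mat_simps[where n = ?n])
  also have "\<dots> = ?J" unfolding G(3) by (simp add: left_mult_one_mat[of _ ?n ?n])
  finally show ?thesis using G(1) by (auto simp: indef_unitary_group_def square_mat_simps[where n = ?n])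
qed

text \<open>A unitary \<open>V\<close> has \<open>V^H\<close> as its inverse, so preserving the form
  means commuting with it. At an entry whose row and column lie in different blocks, commuting says
  that the entry equals its own negative.\<close>

lemma unitary_indef_unitary_block_diag:
  assumes V: "V \<in> indef_unitary_group p q" and VV: "mat_adjoint V * V = 1\<^sub>m (p + q)"
  obtains V1 V2 where "V1 \<in> unitary_group p" "V2 \<in> unitary_group q"
    "V = four_block_mat V1 (0\<^sub>m p q) (0\<^sub>m q p) V2"
proof -
  let ?J = "indef_mat p q :: complex mat" and ?n = "p + q"
  note G = indef_unitary_groupD[OF V]
  have VV': "V * mat_adjoint V = 1\<^sub>m ?n"
    by (rule mat_mult_left_right_inverse[OF _ G(1) VV]) (use G(1) in simp)
  have "V * (mat_adjoint V * ?J * V) = V * mat_adjoint V * (?J * V)"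
    using G(1) by (simp add: square_mat_simps[where n = ?n])
  then have comm: "V * ?J = ?J * V" unfolding G(2) VV' using G(1) by (simp add: square_mat_simps[where n = ?n])
  have V0: "V $$ (i, j) = 0" if "i < p \<and> p \<le> j \<or> p \<le> i \<and> j < p" "i < ?n" "j < ?n" for i j
    using arg_cong[OF comm, of "\<lambda>M. M $$ (i, j)"] that G(1)
    unfolding indef_mat_eq_mat_diag mat_diag_mult_left[OF G(1)] mat_diag_mult_right[OF G(1)] by auto
  define V1 where "V1 = mat p p (\<lambda>(i,j). V $$ (i, j))"
  define V2 where "V2 = mat q q (\<lambda>(i,j). V $$ (p + i, p + j))"
  have c: "V1 \<in> carrier_mat p p" "V2 \<in> carrier_mat q q" by (simp_all add: V1_def V2_def)
  have block: "V = four_block_mat V1 (0\<^sub>m p q) (0\<^sub>m q p) V2"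
    using G(1) by (intro eq_matI) (auto simp: V1_def V2_def V0)
  have z: "mat_adjoint (0\<^sub>m p q) = (0\<^sub>m q p :: complex mat)" "mat_adjoint (0\<^sub>m q p) = (0\<^sub>m p q :: complex mat)"
    by (auto intro!: eq_matI)
  have "four_block_mat (mat_adjoint V1 * V1) (0\<^sub>m p q) (0\<^sub>m q p) (mat_adjoint V2 * V2) = 1\<^sub>m ?n"
    using VV c unfolding block
    by (simp add: mat_adjoint_four_block_mat[of _ p p _ q _ q] z mult_block_diag)
  note e = arg_cong[OF this, of "\<lambda>M. M $$ (i, j)" for i j]
  have "mat_adjoint V1 * V1 = 1\<^sub>m p"
  proof (rule eq_matI)
    fix i j assume "i < dim_row (1\<^sub>m p :: complex mat)" "j < dim_col (1\<^sub>m p :: complex mat)"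
    then show "(mat_adjoint V1 * V1) $$ (i, j) = 1\<^sub>m p $$ (i, j)"
      using e[of i j] c by (simp del: index_mult_mat(1))
  qed (use c in auto)
  moreover have "mat_adjoint V2 * V2 = 1\<^sub>m q"
  proof (rule eq_matI)
    fix i j assume "i < dim_row (1\<^sub>m q :: complex mat)" "j < dim_col (1\<^sub>m q :: complex mat)"
    then show "(mat_adjoint V2 * V2) $$ (i, j) = 1\<^sub>m q $$ (i, j)"
      using e[of "p + i" "p + j"] c by (simp del: index_mult_mat(1))
  qed (use c in auto)
  ultimately show thesis using c block by (intro that[of V1 V2]) (auto simp: unitary_group_def)
qed

lemma hyperbolic_mat_Re_Im:
  assumes "q \<le> p"
  shows "map_mat Re (hyperbolic_mat p q \<theta>) = four_block_mat
      (mat_diag p (\<lambda>i. if i < q then cosh (\<theta> i) else 1)) (0\<^sub>m p q) (0\<^sub>m q p) (mat_diag q (\<lambda>i. cosh (\<theta> i)))"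
    and "map_mat Im (hyperbolic_mat p q \<theta>) = four_block_mat
      (0\<^sub>m p p) (rect_diag p q (\<lambda>i. sinh (\<theta> i))) (- (rect_diag p q (\<lambda>i. sinh (\<theta> i)))\<^sup>T) (0\<^sub>m q q)"
  unfolding hyperbolic_mat_blocks[OF assms]
  by (subst map_four_block_mat[of _ p p _ q _ q], simp_all,
      rule cong_four_block_mat; intro eq_matI; simp add: mat_diag_def rect_diag_def)+

theorem factorization_exists:
  assumes qp: "q \<le> p" and U: "U \<in> indef_unitary_group p q"
  shows "\<exists>Up Uq \<theta> Om. is_factorization p q U Up Uq \<theta> Om"
proof -
  let ?n = "p + q"
  note sq = square_mat_simps[where n = "p + q"]
  note U' = indef_unitary_groupD[OF U]
  obtain G s where G: "G \<in> indef_orthogonal_group p q"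
    and Re_M: "map_mat Re (mat_adjoint U * U) = G\<^sup>T * four_block_mat
      (mat_diag p (\<lambda>i. if i < q then sqrt (1 + s i * s i) else 1)) (0\<^sub>m p q) (0\<^sub>m q p)
      (mat_diag q (\<lambda>i. sqrt (1 + s i * s i))) * G"
    and Im_M: "map_mat Im (mat_adjoint U * U) = G\<^sup>T * four_block_mat
      (0\<^sub>m p p) (rect_diag p q s) (- (rect_diag p q s)\<^sup>T) (0\<^sub>m q q) * G"
    by (rule gram_normal_form[OF qp gram_real_imag[OF U]]; (rule that)?; assumption)
  note G' = indef_orthogonal_groupD[OF G]
  \<comment> \<open>Halved because the Gram matrix contains the square of the hyperbolic factor,
    that is, the doubled angles.\<close>
  define \<theta> where "\<theta> i = arsinh (s i) / 2" for i
  define H where "H = hyperbolic_mat p q \<theta>"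
  define H' where "H' = hyperbolic_mat p q (\<lambda>i. - \<theta> i)"
  have H: "H \<in> carrier_mat ?n ?n" "H' \<in> carrier_mat ?n ?n"
    by (simp_all add: H_def H'_def hyperbolic_mat_carrier[OF qp])
  have HH: "H * H' = 1\<^sub>m ?n" "H' * H = 1\<^sub>m ?n"
    by (simp_all add: H_def H'_def hyperbolic_mat_add[OF qp] hyperbolic_mat_zero[OF qp])
  have H2: "H * H = hyperbolic_mat p q (\<lambda>i. arsinh (s i))"
    by (simp add: H_def hyperbolic_mat_add[OF qp] \<theta>_def)
  define R where "R = complexify G"
  have Ru: "R \<in> indef_unitary_group p q" unfolding R_def by (rule complexify_indef_orthogonal[OF G])
  note R = indef_unitary_groupD[OF Ru]
  \<comment> \<open>The inverse of \<open>R\<close>, written in the form in which its membership in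
    the group is known.\<close>
  define R' where "R' = indef_mat p q * mat_adjoint R * indef_mat p q"
  have R'u: "R' \<in> indef_unitary_group p q" unfolding R'_def by (rule indef_unitary_group_inverse[OF Ru])
  have R': "R' \<in> carrier_mat ?n ?n" using indef_unitary_groupD(1)[OF R'u] .
  have RR: "R * R' = 1\<^sub>m ?n" "R' * R = 1\<^sub>m ?n" using R by (simp_all add: R'_def)
  have cosh: "cosh (arsinh (s i)) = sqrt (1 + s i * s i)" for i
    by (simp add: cosh_arsinh_real power2_eq_square add.commute)
  have M: "mat_adjoint U * U = mat_adjoint R * (H * H) * R"
  proof (rule complex_mat_eqI)
    show "map_mat Re (mat_adjoint U * U) = map_mat Re (mat_adjoint R * (H * H) * R)"
      unfolding R_def mat_adjoint_complexify H2 using G'(1)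
      by (subst map_mat_Re_Im_congruence[of _ ?n])
        (simp_all add: hyperbolic_mat_carrier[OF qp] hyperbolic_mat_Re_Im[OF qp] Re_M cosh cong: if_cong)
    show "map_mat Im (mat_adjoint U * U) = map_mat Im (mat_adjoint R * (H * H) * R)"
      unfolding R_def mat_adjoint_complexify H2 using G'(1)
      by (subst map_mat_Re_Im_congruence[of _ ?n])
        (simp_all add: hyperbolic_mat_carrier[OF qp] hyperbolic_mat_Re_Im[OF qp] Im_M)
  qed
  define V where "V = U * (R' * H')"
  have V: "V \<in> indef_unitary_group p q"
    unfolding V_def H'_def
    by (intro indef_unitary_group_mult U R'u hyperbolic_mat_indef_unitary[OF qp])
  have adj: "mat_adjoint R' * mat_adjoint R = 1\<^sub>m ?n"
  proof -
    have "mat_adjoint (1\<^sub>m ?n) = (1\<^sub>m ?n :: complex mat)" by (rule eq_matI) auto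
    then show ?thesis using mat_adjoint_mult[OF R(1) R'] by (simp add: RR)
  qed
  have "mat_adjoint V * V = H' * (mat_adjoint R' * (mat_adjoint U * U) * R') * H'"
  proof -
    have "mat_adjoint H' = H'" by (simp add: H'_def mat_adjoint_hyperbolic_mat[OF qp])
    then show ?thesis
      using U'(1) R' H by (simp add: V_def mat_adjoint_mult[of _ ?n ?n _ ?n] sq)
  qed
  also have "\<dots> = H' * ((mat_adjoint R' * mat_adjoint R) * (H * H) * (R * R')) * H'"
    unfolding M using R(1) R' H by (simp add: sq)
  also have "\<dots> = (H' * H) * (H * H')"
    unfolding adj RR using H by (simp add: sq)
  finally have "mat_adjoint V * V = 1\<^sub>m ?n" by (simp add: HH)
  then obtain V1 V2 where V12: "V1 \<in> unitary_group p" "V2 \<in> unitary_group q"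
      "V = four_block_mat V1 (0\<^sub>m p q) (0\<^sub>m q p) V2"
    by (rule unitary_indef_unitary_block_diag[OF V])
  have "V * H * R = U * (R' * (H' * H) * R)"
    using U'(1) R' H R(1) by (simp add: V_def sq)
  then have "U = V * H * R" using U'(1) R' by (simp add: HH RR)
  then have "is_factorization p q U V1 V2 \<theta> G"
    using V12 G by (simp add: is_factorization_def H_def R_def)
  then show ?thesis by blast
qed

section \<open>Uniqueness of the angles\<close>

lemma mset_roots_eq:
  fixes xs ys :: "'a :: idom list"
  assumes "(\<Prod>a\<leftarrow>xs. [:- a, 1:]) = (\<Prod>a\<leftarrow>ys. [:- a, 1:])"
  shows "mset xs = mset ys"
proof -
  have "proots (\<Prod>a\<leftarrow>zs. [:- a, 1:]) = mset zs" for zs :: "'a list"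
  proof (induction zs)
    case (Cons z zs)
    have "(\<Prod>a\<leftarrow>zs. [:- a, 1:]) \<noteq> 0" by (auto simp: prod_list_zero_iff)
    then have "proots ([:- z, 1:] * (\<Prod>a\<leftarrow>zs. [:- a, 1:])) = {#z#} + mset zs"
      by (subst proots_mult) (simp_all add: Cons.IH)
    then show ?case by simp
  qed simp
  then show ?thesis using assms by metis
qed

lemma char_poly_mat_diag:
  "char_poly (mat_diag n f) = (\<Prod>a\<leftarrow>map f [0..<n]. [:- a, 1:])"
proof -
  have "char_poly (mat_diag n f) = (\<Prod>a\<leftarrow>diag_mat (mat_diag n f). [:- a, 1:])"
    by (rule char_poly_upper_triangular[of _ n]) (auto simp: mat_diag_def)
  also have "diag_mat (mat_diag n f) = map f [0..<n]"
    by (auto simp: diag_mat_def mat_diag_def)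
  finally show ?thesis .
qed

text \<open>For \<open>U = K H O\<close> with \<open>K\<close> unitary, \<open>U\<^sup>H U = O\<^sup>T H\<^sup>2 O\<close>, and \<open>O\<^sup>T = J O\<^sup>-\<^sup>1 J\<close> turns the
  congruence of the real parts into a similarity.\<close>

lemma factorization_char_poly:
  assumes qp: "q \<le> p" and fac: "is_factorization p q U Up Uq \<theta> Om"
  shows "char_poly (indef_mat p q * map_mat Re (mat_adjoint U * U)) =
    (\<Prod>a\<leftarrow>map (\<lambda>i. if i < q then cosh (2 * \<theta> i) else if i < p then 1 else - cosh (2 * \<theta> (i - p))) [0..<p + q]. [:- a, 1:])"
    (is "_ = (\<Prod>a\<leftarrow>map ?e _. _)")
proof -
  let ?n = "p + q" and ?J = "indef_mat p q :: real mat"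
  note sq = square_mat_simps[where n = "p + q"]
  have Up: "Up \<in> carrier_mat p p" "mat_adjoint Up * Up = 1\<^sub>m p"
    and Uq: "Uq \<in> carrier_mat q q" "mat_adjoint Uq * Uq = 1\<^sub>m q"
    and Om: "Om \<in> indef_orthogonal_group p q"
    using fac by (auto simp: is_factorization_def unitary_group_def)
  note O' = indef_orthogonal_groupD[OF Om]
  define K where "K = four_block_mat Up (0\<^sub>m p q) (0\<^sub>m q p) Uq"
  define H where "H = hyperbolic_mat p q \<theta>"
  define R where "R = complexify Om"
  have K: "K \<in> carrier_mat ?n ?n" using Up Uq by (simp add: K_def four_block_carrier_mat)
  have H: "H \<in> carrier_mat ?n ?n" by (simp add: H_def hyperbolic_mat_carrier[OF qp])
  have R: "R \<in> carrier_mat ?n ?n" using O' by (simp add: R_def)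
  have U: "U = K * H * R" using fac by (simp add: is_factorization_def K_def H_def R_def)
  have "mat_adjoint (0\<^sub>m p q) = (0\<^sub>m q p :: complex mat)" "mat_adjoint (0\<^sub>m q p) = (0\<^sub>m p q :: complex mat)"
    by (auto intro!: eq_matI)
  then have KK: "mat_adjoint K * K = 1\<^sub>m ?n"
    unfolding K_def using Up Uq
    by (simp add: mat_adjoint_four_block_mat[of _ p p _ q _ q] mult_block_diag)
  have "mat_adjoint H = H" by (simp add: H_def mat_adjoint_hyperbolic_mat[OF qp])
  then have "mat_adjoint U * U = mat_adjoint R * (H * (mat_adjoint K * K) * H) * R"
    unfolding U using K H R by (simp add: mat_adjoint_mult[of _ ?n ?n _ ?n] sq)
  also have "\<dots> = complexify Om\<^sup>T * hyperbolic_mat p q (\<lambda>i. 2 * \<theta> i) * complexify Om"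
    using H by (simp add: KK R_def mat_adjoint_complexify H_def hyperbolic_mat_add[OF qp])
  finally have "map_mat Re (mat_adjoint U * U) = Om\<^sup>T * map_mat Re (hyperbolic_mat p q (\<lambda>i. 2 * \<theta> i)) * Om"
    using O'(1) by (simp add: map_mat_Re_Im_congruence[of _ ?n] hyperbolic_mat_carrier[OF qp])
  \<comment> \<open>\<open>?e\<close> absorbs the signs of the form, so the lower block contributes
    negative eigenvalues and the upper block positive ones. Writing the form out in front supplies
    the left factor needed for the inverse of \<open>Om\<close>.\<close>
  also have "map_mat Re (hyperbolic_mat p q (\<lambda>i. 2 * \<theta> i)) = ?J * mat_diag ?n ?e"
    unfolding hyperbolic_mat_Re_Im[OF qp] indef_mat_eq_mat_diag mat_diag_diag using qp
    by (intro eq_matI) (auto simp: mat_diag_def)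
  finally have "?J * map_mat Re (mat_adjoint U * U) = (?J * Om\<^sup>T * ?J) * mat_diag ?n ?e * Om"
    using O'(1) by (simp add: sq)
  then have "similar_mat (?J * map_mat Re (mat_adjoint U * U)) (mat_diag ?n ?e)"
    using O' by (intro similar_matI[of _ _ "?J * Om\<^sup>T * ?J" Om ?n]) (auto simp: sq)
  then show ?thesis unfolding char_poly_mat_diag[symmetric] by (rule char_poly_similar)
qed

text \<open>Both factorizations give the same characteristic polynomial, hence the same multiset of
  eigenvalues. Keeping the negative ones isolates exactly the \<open>q\<close> values
  \<open>- cosh (2 * \<theta> k)\<close>, with multiplicity. Equal multisets over the same index set
  differ by a permutation, and equal values of cosh mean equal absolute values.\<close>

theorem factorization_unique:
  assumes qp: "q \<le> p" and fac: "is_factorization p q U Up Uq \<theta> Om"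
    and fac': "is_factorization p q U Up' Uq' \<theta>' Om'"
  shows "eq_up_to_order_and_signs q \<theta> \<theta>'"
proof -
  let ?e = "\<lambda>\<theta> i. if i < q then cosh (2 * \<theta> i) else if i < p then 1 else - cosh (2 * \<theta> (i - p) :: real)"
  have "mset (map (?e \<theta>') [0..<p + q]) = mset (map (?e \<theta>) [0..<p + q])"
    by (rule mset_roots_eq)
      (simp only: factorization_char_poly[OF qp fac, symmetric]
        factorization_char_poly[OF qp fac', symmetric])
  then have "filter_mset (\<lambda>x. x < 0) (mset (map (?e \<theta>') [0..<p + q])) =
      filter_mset (\<lambda>x. x < 0) (mset (map (?e \<theta>) [0..<p + q]))" by simp
  moreover have "filter_mset (\<lambda>x. x < 0) (mset (map (?e \<theta>) [0..<p + q])) =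
      image_mset (\<lambda>k. - cosh (2 * \<theta> k)) (mset_set {..<q})" for \<theta>
  proof -
    have pos: "filter (\<lambda>x. x < 0) (map (?e \<theta>) [0..<p]) = []"
      by (auto simp: filter_empty_conv not_less)
    have "map (?e \<theta>) [p..<p + q] = map (\<lambda>k. - cosh (2 * \<theta> k)) [0..<q]"
      using qp by (intro nth_equalityI) auto
    moreover have "filter (\<lambda>x. x < 0) (map (\<lambda>k. - cosh (2 * \<theta> k)) [0..<q]) = map (\<lambda>k. - cosh (2 * \<theta> k)) [0..<q]"
      by (auto simp: filter_id_conv)
    moreover have "[0..<p + q] = [0..<p] @ [p..<p + q]" by (rule upt_add_eq_append) simp
    ultimately have "filter (\<lambda>x. x < 0) (map (?e \<theta>) [0..<p + q]) = map (\<lambda>k. - cosh (2 * \<theta> k)) [0..<q]"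
      using pos by (simp only: map_append filter_append append_Nil)
    then have "filter_mset (\<lambda>x. x < 0) (mset (map (?e \<theta>) [0..<p + q])) = mset (map (\<lambda>k. - cosh (2 * \<theta> k)) [0..<q])"
      by (simp only: mset_filter[symmetric])
    then show ?thesis by (simp add: atLeast0LessThan)
  qed
  ultimately have "image_mset (\<lambda>k. - cosh (2 * \<theta>' k)) (mset_set {..<q}) =
      image_mset (\<lambda>k. - cosh (2 * \<theta> k)) (mset_set {..<q})" by simp
  then obtain \<pi> where \<pi>: "\<pi> permutes {..<q}" and eq: "\<forall>k\<in>{..<q}. - cosh (2 * \<theta>' k) = - cosh (2 * \<theta> (\<pi> k))"
    using image_mset_eq_implies_permutes[OF finite_lessThan] by blast
  have "\<theta>' k = \<theta> (\<pi> k) \<or> \<theta>' k = - \<theta> (\<pi> k)" if "k < q" for k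
  proof -
    have "\<bar>2 * \<theta>' k\<bar> = \<bar>2 * \<theta> (\<pi> k)\<bar>" using eq that by (simp flip: cosh_real_eq_iff)
    then show ?thesis by linarith
  qed
  with \<pi> show ?thesis by (auto simp: eq_up_to_order_and_signs_def)
qed

theorem theorem7p10:
  fixes p q :: nat and U :: "complex mat"
  assumes "q \<le> p"
    and "U \<in> indef_unitary_group p q"
  shows "\<exists>Up Uq \<theta> Om. is_factorization p q U Up Uq \<theta> Om \<and>
           (\<forall>Up' Uq' \<theta>' Om'. is_factorization p q U Up' Uq' \<theta>' Om'
              \<longrightarrow> eq_up_to_order_and_signs q \<theta> \<theta>')"
  using factorization_exists[OF assms] factorization_unique[OF assms(1)] by blast

end
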